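(* Consider an $N$-player episodic Markov game (setting and algorithm described in the context). Suppose every agent $i\in\{1,\dots,N\}$ runs the BM-OFTRL algorithm with smooth value updates described in the context for $T$ iterations with learning rate $\eta = \frac{1}{256 N H\sqrt{H A_{\max}}}$, and let $\bar{\pi}=\bar{\pi}_1^T$ be the output correlated policy. Then \[ \operatorname{CE-Gap}(\bar{\pi}) \leq \frac{6144\, N H^{7/2} A_{\max}^{5/2}\log T}{T}. \]
   Context: Markov game: $N$ agents $\mathcal{N}=\{1,\dots,N\}$, horizon $H\in\mathbb{N}_+$, finite state space $\mathcal{S}$, finite action sets $\mathcal{A}_i$ with $A_i=|\mathcal{A}_i|$, $A_{\max}=\max_i A_i$, joint action space $\mathcal{A}_{\mathrm{all}}=\prod_i\mathcal{A}_i$, rewards $r_{h,i}:\mathcal{S}\times\mathcal{A}_{\mathrm{all}}\to[0,1]$, transitions $P_h(\cdot\mid s,\bm a)\in\Delta(\mathcal{S})$, fixed initial state $s_1$. Each episode: at steps $h=1,\dots,H$ agents observe $s_h$, simultaneously pick $a_{h,i}$, agent $i$ gets $r_{h,i}(s_h,\bm a_h)$, and $s_{h+1}\sim P_h(\cdot\mid s_h,\bm a_h)$. For a (possibly correlated, non-Markov) policy, $V_{h,i}(s)$ denotes the expected sum of agent $i$'s rewards from step $h$ to $H$ given $s_h=s$. Notation: for a product of per-agent distributions $\pi_{h}(s,\cdot)=\prod_k\pi_{h,k}(s,\cdot)$, $[Q\pi_h](s)=\sum_{\bm a}Q(s,\bm a)\prod_k\pi_{h,k}(s,a_k)$ and $[Q\pi_{h,-i}](s,a_i)=\sum_{\bm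 a_{-i}}Q(s,a_i,\bm a_{-i})\prod_{k\ne i}\pi_{h,k}(s,a_k)$; $P_h[V](s,\bm a)=\mathbb{E}_{s'\sim P_h(\cdot\mid s,\bm a)}V(s')$. Full information: each agent $i$ can query $[Q_{h,i}\pi_{h,-i}](s,a_i)$ for all $a_i,s$. Weights: $\alpha_t=\frac{H+1}{H+t}$, $\alpha_t^j=\alpha_j\prod_{j'=j+1}^t(1-\alpha_{j'})$ for $1\le j\le t$ (so $\alpha_t^t=\alpha_t$ and $\sum_{j=1}^t\alpha_t^j=1$). At iteration $t$, $w_j=\alpha_t^j/\alpha_t^1$ for $j\in[t]$. Algorithm (agent $i$; all agents run it simultaneously), with learning rate $\eta>0$ and log-barrier regularizer $\mathcal R(\bm x)=-\sum_{a\in\mathcal A_i}\log \bm x[a]$ on $\Delta(\mathcal{A}_i)$. Initialize $Q^0_{h,i}\equiv0$, $\pi^0_{h,i}(s,\cdot)$ uniform, and $Q^t_{H+1,i}\equiv 0$. For $t=1,\dots,T$: (Policy update) for all $s,h$ and each $a_i\in\mathcal{A}_i$, set $\ell^{t,a_i}_{h,i}(s,a_i')=\sum_{j=1}^{t-1}w_j\pi^j_{h,i}(s,a_i)[Q^j_{h,i}\pi^j_{h,-i}](s,a_i')+w_t\pi^{t-1}_{h,i}(s,a_i)[Q^{t-1}_{h,i}\pi^{t-1}_{h,-i}](s,a_i')$ and $q^{t,a_i}_{h,i}(s,\cdot)=\arg\max_{\bm x\in\Delta(\mathcal A_i)}\{\langle \bm x,\eta\,\ell^{t,a_i}_{h,i}(s,\cdot)/w_t\rangle-\mathcal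 R(\bm x)\}$; then $\pi^t_{h,i}(s,\cdot)$ is chosen as a distribution satisfying $\pi^t_{h,i}(s,\cdot)=\sum_{a_i}\pi^t_{h,i}(s,a_i)q^{t,a_i}_{h,i}(s,\cdot)$ (a stationary distribution of the row-stochastic matrix whose $a_i$-th row is $q^{t,a_i}_{h,i}(s,\cdot)$). (Value update) for $h=H,\dots,1$ and all $s,\bm a$: $Q^t_{h,i}(s,\bm a)=(1-\alpha_t)Q^{t-1}_{h,i}(s,\bm a)+\alpha_t\big(r_{h,i}(s,\bm a)+P_h[\,[Q^t_{h+1,i}\pi^t_{h+1}]\,](s,\bm a)\big)$, where $\pi^t_{h+1}$ is the product of all agents' $\pi^t_{h+1,k}$. Output policy: for $h\in[H],t\in[T]$, the correlated policy $\bar\pi_h^t$ (acting from step $h$) is: for $h'=h,\dots,H$, sample $\tau\in[t]$ with $\mathbb P(\tau=j)=\alpha_t^j$ using randomness shared by all agents, let all agents play the product policy $\pi^\tau_{h'}$ at step $h'$, then set $t\leftarrow\tau$. The output is $\bar\pi=\bar\pi_1^T$. Strategy modification for agent $i$: $\phi_i=\{\phi^s_{h,i}:\mathcal A_i\to\mathcal A_i\}_{h,s}$; $\phi_i\diamond\pi$ plays as $\pi$ except that agent $i$'s recommended action $a_i$ at step $h$, state $s$ is replaced by $\phi^s_{h,i}(a_i)$. $\Phi_i$ is the set of all such modifications. $\operatorname{CE-Gap}(\pi)=\max_{i}\max_{\phi_i\in\Phi_i}\big(V^{\phi_i\diamond\pi}_{1,i}(s_1)-V^{\pi}_{1,i}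(s_1)\big)$.
   Formalization: The number of iterations T is assumed to be at least 2: for T = 1 the right-hand side is 0, while the output is the uniform product policy, whose CE-Gap can be positive (one agent, H = 1, two actions with rewards 1 and 0 give gap 1/2). *)

theory Defs
  imports "HOL-Analysis.Analysis" "HOL-Library.FuncSet"
begin

(* Agents are indexed 0..N-1; agent i has action set Act i (finite, nonempty).
   Joint actions are extensional functions on {..<N}. *)
definition joint :: "nat \<Rightarrow> (nat \<Rightarrow> 'a set) \<Rightarrow> (nat \<Rightarrow> 'a) set" where
  "joint N Act = PiE {..<N} Act"

definition prodQ :: "nat \<Rightarrow> (nat \<Rightarrow> 'a set) \<Rightarrow> ('s \<Rightarrow> (nat \<Rightarrow> 'a) \<Rightarrow> real)
    \<Rightarrow> (nat \<Rightarrow> 's \<Rightarrow> 'a \<Rightarrow> real) \<Rightarrow> 's \<Rightarrow> real" where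
  "prodQ N Act Q pol s = (\<Sum>a\<in>joint N Act. Q s a * (\<Prod>k<N. pol k s (a k)))"

definition prodQ_minus :: "nat \<Rightarrow> (nat \<Rightarrow> 'a set) \<Rightarrow> ('s \<Rightarrow> (nat \<Rightarrow> 'a) \<Rightarrow> real)
    \<Rightarrow> (nat \<Rightarrow> 's \<Rightarrow> 'a \<Rightarrow> real) \<Rightarrow> nat \<Rightarrow> 's \<Rightarrow> 'a \<Rightarrow> real" where
  "prodQ_minus N Act Q pol i s ai =
     (\<Sum>b\<in>PiE ({..<N} - {i}) Act. Q s (b(i := ai)) * (\<Prod>k\<in>{..<N} - {i}. pol k s (b k)))"

definition prob_simplex :: "'a set \<Rightarrow> ('a \<Rightarrow> real) set" where
  "prob_simplex A = {x. (\<forall>a\<in>A. 0 \<le> x a) \<and> (\<Sum>a\<in>A. x a) = 1}"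

(* objective <x, g> - R(x) with log-barrier R(x) = - sum_a log x[a] *)
definition lb_obj :: "'a set \<Rightarrow> ('a \<Rightarrow> real) \<Rightarrow> ('a \<Rightarrow> real) \<Rightarrow> real" where
  "lb_obj A g x = (\<Sum>a\<in>A. x a * g a) + (\<Sum>a\<in>A. ln (x a))"

(* x is the argmax over the prob_simplex of <x,g> - R(x); R = +infinity on the boundary,
   so the maximisation ranges over the relative interior (dom R). *)
definition is_lb_argmax :: "'a set \<Rightarrow> ('a \<Rightarrow> real) \<Rightarrow> ('a \<Rightarrow> real) \<Rightarrow> bool" where
  "is_lb_argmax A g x \<longleftrightarrow> x \<in> prob_simplex A \<and> (\<forall>a\<in>A. 0 < x a) \<and>
     (\<forall>y\<in>prob_simplex A. (\<forall>a\<in>A. 0 < y a) \<longrightarrow> lb_obj A g y \<le> lb_obj A g x)"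

definition alpha :: "nat \<Rightarrow> nat \<Rightarrow> real" where
  "alpha H t = (real H + 1) / (real H + real t)"

definition alpha_w :: "nat \<Rightarrow> nat \<Rightarrow> nat \<Rightarrow> real" where
  "alpha_w H t j = alpha H j * (\<Prod>j'\<in>{j+1..t}. (1 - alpha H j'))"

definition wgt :: "nat \<Rightarrow> nat \<Rightarrow> nat \<Rightarrow> real" where
  "wgt H t j = alpha_w H t j / alpha_w H t 1"

(* pol t h i s a  = pi^t_{h,i}(s,a);   Q t h i s a = Q^t_{h,i}(s,a) *)
definition loss ::
  "nat \<Rightarrow> nat \<Rightarrow> (nat \<Rightarrow> 'a set)
   \<Rightarrow> (nat \<Rightarrow> nat \<Rightarrow> nat \<Rightarrow> 's \<Rightarrow> 'a \<Rightarrow> real)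
   \<Rightarrow> (nat \<Rightarrow> nat \<Rightarrow> nat \<Rightarrow> 's \<Rightarrow> (nat \<Rightarrow> 'a) \<Rightarrow> real)
   \<Rightarrow> nat \<Rightarrow> nat \<Rightarrow> nat \<Rightarrow> 's \<Rightarrow> 'a \<Rightarrow> 'a \<Rightarrow> real" where
  "loss N H Act pol Q t h i s ai ai' =
     (\<Sum>j\<in>{1..<t}. wgt H t j * pol j h i s ai * prodQ_minus N Act (Q j h i) (pol j h) i s ai')
     + wgt H t t * pol (t-1) h i s ai * prodQ_minus N Act (Q (t-1) h i) (pol (t-1) h) i s ai'"

(* (pol, Q) is a run of BM-OFTRL with smooth value updates (all agents simultaneously),
   for T iterations with learning rate eta. The stationary distribution pi^t_{h,i}(s,.)
   may be any one satisfying the fixed-point equation. *)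
definition bm_oftrl_run ::
  "nat \<Rightarrow> nat \<Rightarrow> (nat \<Rightarrow> 'a set)
   \<Rightarrow> (nat \<Rightarrow> nat \<Rightarrow> 's::finite \<Rightarrow> (nat \<Rightarrow> 'a) \<Rightarrow> real)
   \<Rightarrow> (nat \<Rightarrow> 's \<Rightarrow> (nat \<Rightarrow> 'a) \<Rightarrow> 's \<Rightarrow> real)
   \<Rightarrow> real \<Rightarrow> nat
   \<Rightarrow> (nat \<Rightarrow> nat \<Rightarrow> nat \<Rightarrow> 's \<Rightarrow> 'a \<Rightarrow> real)
   \<Rightarrow> (nat \<Rightarrow> nat \<Rightarrow> nat \<Rightarrow> 's \<Rightarrow> (nat \<Rightarrow> 'a) \<Rightarrow> real) \<Rightarrow> bool" where
  "bm_oftrl_run N H Act r P \<eta> T pol Q \<longleftrightarrow>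
     (\<forall>h\<in>{1..H}. \<forall>i<N. \<forall>s. \<forall>a\<in>Act i. pol 0 h i s a = 1 / real (card (Act i))) \<and>
     (\<forall>h i s a. Q 0 h i s a = 0) \<and>
     (\<forall>t i s a. Q t (H+1) i s a = 0) \<and>
     (\<forall>t\<in>{1..T}. \<forall>h\<in>{1..H}. \<forall>i<N. \<forall>s.
        pol t h i s \<in> prob_simplex (Act i) \<and>
        (\<exists>q. (\<forall>ai\<in>Act i.
                 is_lb_argmax (Act i) (\<lambda>ai'. \<eta> * loss N H Act pol Q t h i s ai ai' / wgt H t t) (q ai)) \<and>
             (\<forall>ai'\<in>Act i. pol t h i s ai' = (\<Sum>ai\<in>Act i. pol t h i s ai * q ai ai')))) \<and>
     (\<forall>t\<in>{1..T}. \<forall>h\<in>{1..H}. \<forall>i<N. \<forall>s. \<forall>a\<in>joint N Act.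
        Q t h i s a = (1 - alpha H t) * Q (t-1) h i s a
          + alpha H t * (r h i s a + (\<Sum>s'\<in>UNIV. P h s a s' * prodQ N Act (Q t (h+1) i) (pol t (h+1)) s')))"

(* Value V^{phi_i <> pibar^t_h}_{h,i}(s) of the (modified) output correlated policy.
   Argument m = number of remaining steps, current step h = H - m + 1 (as Suc m remaining
   means h = H - m).  The shared latent index tau is the only memory of pibar. *)
fun Vout ::
  "nat \<Rightarrow> nat \<Rightarrow> (nat \<Rightarrow> 'a set)
   \<Rightarrow> (nat \<Rightarrow> nat \<Rightarrow> 's::finite \<Rightarrow> (nat \<Rightarrow> 'a) \<Rightarrow> real)
   \<Rightarrow> (nat \<Rightarrow> 's \<Rightarrow> (nat \<Rightarrow> 'a) \<Rightarrow> 's \<Rightarrow> real)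
   \<Rightarrow> (nat \<Rightarrow> nat \<Rightarrow> nat \<Rightarrow> 's \<Rightarrow> 'a \<Rightarrow> real)
   \<Rightarrow> nat \<Rightarrow> (nat \<Rightarrow> 's \<Rightarrow> 'a \<Rightarrow> 'a) \<Rightarrow> nat \<Rightarrow> nat \<Rightarrow> 's \<Rightarrow> real" where
  "Vout N H Act r P pol i \<phi> 0 t s = 0"
| "Vout N H Act r P pol i \<phi> (Suc m) t s =
     (let h = H - m in
      \<Sum>j\<in>{1..t}. alpha_w H t j *
        (\<Sum>a\<in>joint N Act. (\<Prod>k<N. pol j h k s (a k)) *
           (let a' = a(i := \<phi> h s (a i)) in
              r h i s a' + (\<Sum>s'\<in>UNIV. P h s a' s' * Vout N H Act r P pol i \<phi> m j s'))))"

definition strat_mods :: "(nat \<Rightarrow> 'a set) \<Rightarrow> nat \<Rightarrow> (nat \<Rightarrow> 's \<Rightarrow> 'a \<Rightarrow> 'a) set" where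
  "strat_mods Act i = {\<phi>. \<forall>h s a. a \<in> Act i \<longrightarrow> \<phi> h s a \<in> Act i}"

definition ce_gap ::
  "nat \<Rightarrow> nat \<Rightarrow> (nat \<Rightarrow> 'a set)
   \<Rightarrow> (nat \<Rightarrow> nat \<Rightarrow> 's::finite \<Rightarrow> (nat \<Rightarrow> 'a) \<Rightarrow> real)
   \<Rightarrow> (nat \<Rightarrow> 's \<Rightarrow> (nat \<Rightarrow> 'a) \<Rightarrow> 's \<Rightarrow> real)
   \<Rightarrow> (nat \<Rightarrow> nat \<Rightarrow> nat \<Rightarrow> 's \<Rightarrow> 'a \<Rightarrow> real) \<Rightarrow> nat \<Rightarrow> 's \<Rightarrow> real" where
  "ce_gap N H Act r P pol T s1 =
     (SUP p\<in>{(i, \<phi>). i < N \<and> \<phi> \<in> strat_mods Act i}.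
        Vout N H Act r P pol (fst p) (snd p) H T s1
        - Vout N H Act r P pol (fst p) (\<lambda>h s a. a) H T s1)"

definition A_max :: "nat \<Rightarrow> (nat \<Rightarrow> 'a set) \<Rightarrow> nat" where
  "A_max N Act = Max ((\<lambda>i. card (Act i)) ` {..<N})"

end

(* For a fixed step, state and agent, each row of the transition matrix is produced by optimistic FTRL with
   the log-barrier, and since the fixed-point equation makes the played policy stationary for the matrix, the
   swap regret is the sum of the external regrets of the rows. Each row regret is a comparator term of order
   A log T / eta, plus the squared variation of the utilities, minus the squared relative variation of the
   row. The stationary distribution moves by at most a constant times the relative variation of the rows,
   and the utilities of an agent move only with the value estimates and the policies of the other agents.
   Because swap regret is nonnegative (take the identity), adding the bounds over all agents controls the
   total drift of the policies, so every agent's swap regret at iteration t is O(H A^2 log T / (eta t)).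
   The gaps of the output policy then satisfy gap_h(t) <= regret_h(t) + sum_j alpha_t^j gap_(h+1)(j), and
   sum_j alpha_t^j / j <= (1 + 1/H) / t makes this recursion lose only a factor e over H steps. *)
theory Submission
  imports Defs
begin

section \<open>Log-barrier maximisers\<close>

text \<open>The log-barrier fits this problem because its regret carries a negative term made of
  squared relative changes of the rows. A stationary distribution is controlled by exactly such
  relative changes, with no mixing-time constant, so the term that the regret gives back is the one
  that pays for the drift of the played policy. The loop closes only if the drift returns with a
  small coefficient. Squared drift costs 3 \<eta> H^2 N through the utilities; passing from drift to
  row changes costs 16 A by perturbation and Cauchy-Schwarz, and another 2 H because the drift at
  round j + 1 is paid by the rows at round j, whose weight can be smaller by that factor; the
  negative term has coefficient 1 / (6 \<eta>). Over N agents this makes 576 \<eta>^2 N^2 H^3 A, and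
  the prescribed \<eta> turns it into 576 / 65536. This is where the N, the H sqrt(H) and the
  sqrt(A) in 1 / \<eta> come from.\<close>

lemma lb_argmax_foc:
  fixes g q :: "'a \<Rightarrow> real"
  assumes fin: "finite A" and arg: "is_lb_argmax A g q" and a: "a \<in> A" and b: "b \<in> A"
  shows "g a + 1 / q a = g b + 1 / q b"
proof (cases "a = b")
  case False
  have pos: "\<And>c. c \<in> A \<Longrightarrow> 0 < q c" and sum1: "(\<Sum>c\<in>A. q c) = 1"
    and opt: "\<And>y. y \<in> prob_simplex A \<Longrightarrow> (\<forall>c\<in>A. 0 < y c) \<Longrightarrow> lb_obj A g y \<le> lb_obj A g q"
    using arg unfolding is_lb_argmax_def prob_simplex_def by auto
  define d where "d = min (q a) (q b)"
  have d: "d > 0" using pos a b by (simp add: d_def)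
  define B where "B = A - {a, b}"
  have split: "(\<Sum>c\<in>A. f c) = f a + f b + (\<Sum>c\<in>B. f c)" for f :: "'a \<Rightarrow> real"
  proof -
    have "b \<in> A - {a}" "A - {a} - {b} = B" using b False by (auto simp: B_def)
    then show ?thesis using sum.remove[OF fin a, of f] sum.remove[of "A - {a}" b f] fin by simp
  qed
  \<comment> \<open>Mass \<open>e\<close> moves from \<open>b\<close> to \<open>a\<close>. For
    \<open>\<bar>e\<bar> < d\<close> both coordinates stay positive, so the moved point remains a
    competitor and 0 is an interior maximum of \<open>\<phi>\<close>, the part of the objective that
    depends on \<open>e\<close>.\<close>
  define \<phi> where "\<phi> e = e * (g a - g b) + ln (q a + e) + ln (q b - e)" for e
  have le: "\<phi> e \<le> \<phi> 0" if e: "\<bar>0 - e\<bar> < d" for e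
  proof -
    define y where "y = q(a := q a + e, b := q b - e)"
    have ya: "y a = q a + e" and yb: "y b = q b - e" using False by (auto simp: y_def)
    have yB: "y c = q c" if "c \<in> B" for c using that by (auto simp: y_def B_def)
    have "\<forall>c\<in>A. 0 < y c" using pos e a b by (auto simp: y_def d_def)
    moreover have "(\<Sum>c\<in>A. y c) = 1" using sum1 unfolding split by (simp add: ya yb yB)
    ultimately have "lb_obj A g y \<le> lb_obj A g q"
      by (intro opt) (auto simp: prob_simplex_def less_imp_le)
    then show ?thesis unfolding lb_obj_def split
      by (simp add: ya yb yB \<phi>_def algebra_simps)
  qed
  have "(\<phi> has_real_derivative (g a - g b + 1 / q a - 1 / q b)) (at 0)"
    unfolding \<phi>_def using pos[OF a] pos[OF b] by (auto intro!: derivative_eq_intros simp: divide_simps)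
  from DERIV_local_max[OF this d] le show ?thesis by simp
qed simp

text \<open>The first-order condition makes \<open>g\<close> a constant minus
  \<open>1 / q b\<close>, and the constant cancels between two points of the simplex. The maximiser
  is interior, so the gap is exactly the Bregman divergence of the log-barrier from \<open>x\<close>
  to \<open>q\<close>.\<close>

lemma log_barrier_gap:
  fixes q x :: "'a \<Rightarrow> real"
  assumes fin: "finite A" and arg: "is_lb_argmax A g q"
    and x: "x \<in> prob_simplex A" and xpos: "\<And>b. b \<in> A \<Longrightarrow> 0 < x b"
  shows "lb_obj A g q - lb_obj A g x = (\<Sum>b\<in>A. x b / q b - 1 - ln (x b / q b))"
proof -
  have pos: "\<And>c. c \<in> A \<Longrightarrow> 0 < q c" and sum1: "(\<Sum>c\<in>A. q c) = 1"
    using arg unfolding is_lb_argmax_def prob_simplex_def by auto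
  have sx: "(\<Sum>c\<in>A. x c) = 1" using x by (simp add: prob_simplex_def)
  obtain k where k: "\<And>b. b \<in> A \<Longrightarrow> g b = k - 1 / q b"
  proof (cases "A = {}")
    case False
    then obtain a where a: "a \<in> A" by auto
    show ?thesis using lb_argmax_foc[OF fin arg a] 
      by (intro that[of "g a + 1 / q a"]) (simp add: algebra_simps)
  qed (use that in auto)
  have "(\<Sum>b\<in>A. (q b - x b) * g b) = (\<Sum>b\<in>A. (q b - x b) * k + (x b / q b - 1))"
    using pos by (intro sum.cong) (auto simp: k field_simps dest: less_imp_neq[OF pos])
  also have "\<dots> = (\<Sum>b\<in>A. x b / q b - 1)"
    by (simp add: sum.distrib sum_subtractf sum1 sx flip: sum_distrib_right)
  finally have 1: "(\<Sum>b\<in>A. (q b - x b) * g b) = (\<Sum>b\<in>A. x b / q b - 1)" .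
  have 2: "ln (x b / q b) = ln (x b) - ln (q b)" if "b \<in> A" for b
    using pos[OF that] xpos[OF that] by (simp add: ln_div)
  show ?thesis using 1 unfolding lb_obj_def
    by (simp add: 2 sum_subtractf sum.distrib left_diff_distrib)
qed

text \<open>Minus this sum is the barrier shifted to vanish at the uniform distribution. Its
  nonnegativity lets the weight of the regulariser grow in \<open>oftrl_regret\<close> without
  raising the potential.\<close>

lemma log_barrier_nonneg:
  fixes x :: "'a \<Rightarrow> real"
  assumes fin: "finite A" and x: "x \<in> prob_simplex A" and xpos: "\<And>b. b \<in> A \<Longrightarrow> 0 < x b"
  shows "(\<Sum>b\<in>A. ln (real (card A) * x b)) \<le> 0"
proof -
  have n: "A \<noteq> {}" using x by (auto simp: prob_simplex_def)
  then have c: "real (card A) > 0" using fin by (simp add: card_gt_0_iff)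
  have "(\<Sum>b\<in>A. ln (real (card A) * x b)) \<le> (\<Sum>b\<in>A. real (card A) * x b - 1)"
    by (intro sum_mono ln_le_minus_one mult_pos_pos c xpos)
  also have "\<dots> = 0" using x by (simp add: sum_subtractf prob_simplex_def flip: sum_distrib_left)
  finally show ?thesis .
qed

text \<open>The reciprocals of the two maximisers differ by the change of the gradients and a common
  multiplier shift \<open>l\<close>. If \<open>l\<close> left [-d, d], all coordinates would move in
  the same direction, which two points of the simplex cannot do. Multiplying by \<open>q' b\<close>
  makes the change relative.\<close>

lemma log_barrier_stable:
  fixes q q' g g' :: "'a \<Rightarrow> real"
  assumes fin: "finite A" and arg: "is_lb_argmax A g q" and arg': "is_lb_argmax A g' q'"
    and d: "\<And>b. b \<in> A \<Longrightarrow> \<bar>g' b - g b\<bar> \<le> d" and b: "b \<in> A"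
  shows "\<bar>q' b / q b - 1\<bar> \<le> 2 * d * q' b"
proof -
  have pos: "\<And>c. c \<in> A \<Longrightarrow> 0 < q c" and sum1: "(\<Sum>c\<in>A. q c) = 1"
    using arg unfolding is_lb_argmax_def prob_simplex_def by auto
  have pos': "\<And>c. c \<in> A \<Longrightarrow> 0 < q' c" and sum1': "(\<Sum>c\<in>A. q' c) = 1"
    using arg' unfolding is_lb_argmax_def prob_simplex_def by auto
  define l where "l = (g' b + 1 / q' b) - (g b + 1 / q b)"
  have l: "1 / q' c - 1 / q c = l - (g' c - g c)" if "c \<in> A" for c
    using lb_argmax_foc[OF fin arg b that] lb_argmax_foc[OF fin arg' b that]
    by (simp add: l_def)
  have ne: "A \<noteq> {}" using b by auto
  have "l \<le> d"
  proof (rule ccontr)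
    assume "\<not> l \<le> d"
    then have "q' c < q c" if "c \<in> A" for c
    proof -
      have "1 / q c < 1 / q' c" using l[OF that] d[OF that] \<open>\<not> l \<le> d\<close> by linarith
      then show ?thesis using pos[OF that] pos'[OF that] by (simp add: field_simps)
    qed
    then have "(\<Sum>c\<in>A. q' c) < (\<Sum>c\<in>A. q c)" using fin ne by (intro sum_strict_mono) auto
    then show False using sum1 sum1' by simp
  qed
  moreover have "- d \<le> l"
  proof (rule ccontr)
    assume "\<not> - d \<le> l"
    then have "q c < q' c" if "c \<in> A" for c
    proof -
      have "1 / q' c < 1 / q c" using l[OF that] d[OF that] \<open>\<not> - d \<le> l\<close> by linarith
      then show ?thesis using pos[OF that] pos'[OF that] by (simp add: field_simps)
    qed
    then have "(\<Sum>c\<in>A. q c) < (\<Sum>c\<in>A. q' c)" using fin ne by (intro sum_strict_mono) auto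
    then show False using sum1 sum1' by simp
  qed
  ultimately have "\<bar>1 / q' b - 1 / q b\<bar> \<le> 2 * d" using l[OF b] d[OF b] by linarith
  then have "q' b * \<bar>1 / q' b - 1 / q b\<bar> \<le> q' b * (2 * d)"
    using pos'[OF b] by (intro mult_left_mono) auto
  moreover have "q' b * \<bar>1 / q' b - 1 / q b\<bar> = \<bar>q' b * (1 / q' b - 1 / q b)\<bar>"
    using pos'[OF b] by (simp add: abs_mult)
  moreover have "q' b * (1 / q' b - 1 / q b) = - (q' b / q b - 1)"
    using pos'[OF b] by (simp add: algebra_simps)
  ultimately show ?thesis by (simp only: abs_minus_cancel mult_ac)
qed

text \<open>The derivative of the difference is \<open>(y - 1) * (1 / y - 2 / 3)\<close>, whose
  second factor is nonnegative up to y = 3/2. This ties the constant 1/3 to the radius 1/2.\<close>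

lemma minus_ln_quadratic:
  fixes z :: real
  assumes "\<bar>z - 1\<bar> \<le> 1/2"
  shows "(z - 1)\<^sup>2 / 3 \<le> z - 1 - ln z"
proof -
  define f where "f y = y - 1 - ln y - (y - 1)\<^sup>2 / 3" for y :: real
  have der: "(f has_real_derivative (y - 1) * (1 / y - 2 / 3)) (at y)" if "y > 0" for y
    unfolding f_def using that
    by (auto intro!: derivative_eq_intros simp: field_simps power2_eq_square)
  have "f z \<ge> f 1"
  proof (cases "z \<ge> 1")
    case True
    show ?thesis
    proof (rule DERIV_nonneg_imp_nondecreasing[OF True])
      fix y assume y: "1 \<le> y" "y \<le> z"
      then have "1 / y \<ge> 2 / 3" using assms by (simp add: field_simps)
      then show "\<exists>D. (f has_real_derivative D) (at y) \<and> 0 \<le> D" using der[of y] y by fastforce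
    qed
  next
    case False
    show ?thesis
    proof (rule DERIV_nonpos_imp_nonincreasing[of z 1])
      fix y assume y: "z \<le> y" "y \<le> 1"
      then have yp: "y > 0" using assms by simp
      then have "1 / y \<ge> 2 / 3" using y by (simp add: field_simps)
      then have "(y - 1) * (1 / y - 2 / 3) \<le> 0" using y by (simp add: mult_nonpos_nonneg)
      then show "\<exists>D. (f has_real_derivative D) (at y) \<and> D \<le> 0" using der[OF yp] by blast
    qed (use False in auto)
  qed
  then show ?thesis by (simp add: f_def)
qed

section \<open>Perturbation of stationary distributions\<close>

definition stationary :: "'a set \<Rightarrow> ('a \<Rightarrow> 'a \<Rightarrow> real) \<Rightarrow> ('a \<Rightarrow> real) \<Rightarrow> bool" where
  "stationary A M p \<longleftrightarrow> p \<in> prob_simplex A \<and> (\<forall>b\<in>A. p b = (\<Sum>a\<in>A. p a * M a b))"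

definition pos_stochastic :: "'a set \<Rightarrow> ('a \<Rightarrow> 'a \<Rightarrow> real) \<Rightarrow> bool" where
  "pos_stochastic A M \<longleftrightarrow> (\<forall>a\<in>A. (\<forall>b\<in>A. 0 < M a b) \<and> (\<Sum>b\<in>A. M a b) = 1)"

text \<open>State elimination: a stationary distribution of the chain watched on the remaining states extends to the eliminated one.\<close>
lemma stationary_exists:
  assumes "finite A" "A \<noteq> {}" "pos_stochastic A M"
  shows "\<exists>p. stationary A M p"
  using assms
proof (induction A arbitrary: M rule: finite_ne_induct)
  case (singleton x)
  then show ?case
    by (intro exI[of _ "\<lambda>_. 1"]) (auto simp: stationary_def pos_stochastic_def prob_simplex_def)
next
  case (insert c B)
  have Mp: "\<And>a b. a \<in> insert c B \<Longrightarrow> b \<in> insert c B \<Longrightarrow> 0 < M a b"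
    and Ms: "\<And>a. a \<in> insert c B \<Longrightarrow> M a c + (\<Sum>b\<in>B. M a b) = 1"
    using insert.prems insert.hyps by (auto simp: pos_stochastic_def)
  define s where "s = 1 - M c c"
  have s: "s = (\<Sum>b\<in>B. M c b)" using Ms[of c] by (simp add: s_def)
  have sp: "s > 0" unfolding s using insert.hyps Mp by (intro sum_pos) auto
  \<comment> \<open>The chain watched on \<open>B\<close>: a direct step to \<open>b\<close>, or a
    detour to \<open>c\<close> that is finally left towards \<open>b\<close>, with probability
    \<open>M c b / s\<close>.\<close>
  define K where "K a b = M a b + M a c * M c b / s" for a b
  have "pos_stochastic B K"
    unfolding pos_stochastic_def
  proof (intro ballI conjI)
    fix a b assume "a \<in> B" "b \<in> B"
    then show "0 < K a b" using Mp sp by (simp add: K_def add_pos_nonneg less_imp_le)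
  next
    fix a assume a: "a \<in> B"
    have "(\<Sum>b\<in>B. K a b) = (\<Sum>b\<in>B. M a b) + M a c * (\<Sum>b\<in>B. M c b) / s"
      by (simp add: K_def sum.distrib sum_distrib_left sum_divide_distrib)
    then show "(\<Sum>b\<in>B. K a b) = 1" using Ms[of a] a sp by (simp flip: s)
  qed
  then obtain p where p: "stationary B K p" using insert.IH by blast
  have pnn: "\<And>b. b \<in> B \<Longrightarrow> 0 \<le> p b" and psum: "(\<Sum>b\<in>B. p b) = 1"
    and peq: "\<And>b. b \<in> B \<Longrightarrow> p b = (\<Sum>a\<in>B. p a * K a b)"
    using p by (auto simp: stationary_def prob_simplex_def)
  \<comment> \<open>The balance at \<open>c\<close>: its outflow \<open>y * s\<close> equals the
    inflow from \<open>B\<close>. The total mass is normalised at the end.\<close>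
  define y where "y = (\<Sum>a\<in>B. p a * M a c) / s"
  have ynn: "y \<ge> 0" unfolding y_def using sp pnn Mp
    by (intro divide_nonneg_nonneg sum_nonneg mult_nonneg_nonneg) (auto simp: less_imp_le)
  define x where "x = p(c := y)"
  have xB: "x b = p b" if "b \<in> B" for b using that insert.hyps by (auto simp: x_def)
  have xc: "x c = y" by (simp add: x_def)
  have eq: "x b = (\<Sum>a\<in>insert c B. x a * M a b)" if "b \<in> insert c B" for b
  proof (cases "b = c")
    case True
    have "(\<Sum>a\<in>insert c B. x a * M a c) = y * M c c + y * s"
      using insert.hyps sp by (simp add: xc xB y_def)
    also have "\<dots> = y" by (simp add: s_def algebra_simps)
    finally show ?thesis using True xc by simp
  next
    case False
    then have b: "b \<in> B" using that by simp
    have "(\<Sum>a\<in>insert c B. x a * M a b) = y * M c b + (\<Sum>a\<in>B. p a * M a b)"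
      using insert.hyps by (simp add: xc xB)
    also have "\<dots> = (\<Sum>a\<in>B. p a * K a b)"
      unfolding y_def K_def
      by (simp add: algebra_simps sum.distrib sum_distrib_left sum_divide_distrib)
    finally show ?thesis using peq[OF b] xB[OF b] by simp
  qed
  define Z where "Z = 1 + y"
  have Z: "Z > 0" using ynn by (simp add: Z_def)
  have "(\<Sum>a\<in>insert c B. x a) = Z" using insert.hyps by (simp add: xc xB psum Z_def)
  then have "stationary (insert c B) M (\<lambda>b. x b / Z)"
    unfolding stationary_def prob_simplex_def using Z eq ynn pnn
    by (auto simp: xc xB divide_simps simp flip: sum_divide_distrib)
  then show ?case by blast
qed

lemma stationary_pos:
  assumes fin: "finite A" and M: "pos_stochastic A M" and p: "stationary A M p" and b: "b \<in> A"
  shows "0 < p b"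
proof -
  have nn: "\<And>a. a \<in> A \<Longrightarrow> 0 \<le> p a" and s: "(\<Sum>a\<in>A. p a) = 1"
    and eq: "p b = (\<Sum>a\<in>A. p a * M a b)"
    using p b by (auto simp: stationary_def prob_simplex_def)
  have Mp: "\<And>a. a \<in> A \<Longrightarrow> 0 < M a b" using M b by (auto simp: pos_stochastic_def)
  obtain a where a: "a \<in> A" "p a \<noteq> 0" using s by (metis sum.neutral zero_neq_one)
  show ?thesis unfolding eq
    using a nn Mp by (intro sum_pos2[OF fin a(1)]) (auto simp: less_le)
qed

text \<open>A maximum principle for the ratio of the two stationary distributions, which away from \<open>a\<close>
  averages itself under the time-reversed chain.\<close>
lemma stationary_one_row:
  fixes M M' :: "'a \<Rightarrow> 'a \<Rightarrow> real"
  assumes fin: "finite A" and M: "pos_stochastic A M" and M': "pos_stochastic A M'"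
    and p: "stationary A M p" and p': "stationary A M' p'" and a: "a \<in> A"
    and other: "\<And>c b. c \<in> A \<Longrightarrow> c \<noteq> a \<Longrightarrow> b \<in> A \<Longrightarrow> M' c b = M c b"
    and row: "\<And>b. b \<in> A \<Longrightarrow> \<bar>M' a b - M a b\<bar> \<le> e * M a b" and e: "e \<le> 1/2"
  shows "(\<Sum>b\<in>A. \<bar>p' b - p b\<bar>) \<le> 4 * e"
proof -
  have pp: "\<And>b. b \<in> A \<Longrightarrow> 0 < p b" and pp': "\<And>b. b \<in> A \<Longrightarrow> 0 < p' b"
    using stationary_pos fin M M' p p' by metis+
  have s: "(\<Sum>a\<in>A. p a) = 1" and s': "(\<Sum>a\<in>A. p' a) = 1"
    using p p' by (auto simp: stationary_def prob_simplex_def)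
  have Mp: "\<And>c b. c \<in> A \<Longrightarrow> b \<in> A \<Longrightarrow> 0 < M c b" using M by (auto simp: pos_stochastic_def)
  have e0: "0 \<le> e" using row[OF a] Mp[OF a a] 
    by (smt (verit, best) mult_neg_pos)
  define k where "k = p' a / p a"
  have k: "k > 0" using pp pp' a by (simp add: k_def)
  have p'a: "p' a = k * p a" using pp[OF a] by (simp add: k_def)
  define f where "f b = p' b / p b" for b
  have p'f: "p' b = f b * p b" if "b \<in> A" for b using pp[OF that] by (simp add: f_def)
  have eq: "p b = p a * M a b + (\<Sum>c\<in>A-{a}. p c * M c b)" if "b \<in> A" for b
    using p that sum.remove[OF fin a, of "\<lambda>c. p c * M c b"] by (simp add: stationary_def)
  have eq': "p' b = p' a * M' a b + (\<Sum>c\<in>A-{a}. p' c * M c b)" if "b \<in> A" for b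
  proof -
    have "p' b = p' a * M' a b + (\<Sum>c\<in>A-{a}. p' c * M' c b)"
      using p' that sum.remove[OF fin a, of "\<lambda>c. p' c * M' c b"] by (simp add: stationary_def)
    also have "(\<Sum>c\<in>A-{a}. p' c * M' c b) = (\<Sum>c\<in>A-{a}. p' c * M c b)"
      using that other by (intro sum.cong) auto
    finally show ?thesis .
  qed
  have ne: "A \<noteq> {}" using a by auto
  \<comment> \<open>At a maximiser \<open>m\<close> the balance equation makes \<open>f m\<close> an
    average of ratios \<open>f c\<close> with \<open>c \<noteq> a\<close> and of a
    row-\<open>a\<close> term that is at most \<open>(1 + e) * k\<close>. The latter has positive
    weight since \<open>M a m > 0\<close>, so the maximum cannot exceed it.\<close>
  have up: "f b \<le> (1 + e) * k" if "b \<in> A" for b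
  proof -
    have "Max (f ` A) \<in> f ` A" using fin ne by simp
    then obtain m where m: "m \<in> A" "f m = Max (f ` A)" by auto
    have fm: "f c \<le> f m" if "c \<in> A" for c using m(2) that fin by simp
    have "f m \<le> (1 + e) * k"
    proof (rule ccontr)
      assume n: "\<not> f m \<le> (1 + e) * k"
      have "p' m = p' a * M' a m + (\<Sum>c\<in>A-{a}. p' c * M c m)" using eq' m by simp
      also have "(\<Sum>c\<in>A-{a}. p' c * M c m) \<le> (\<Sum>c\<in>A-{a}. f m * (p c * M c m))"
      proof (intro sum_mono)
        fix c assume c: "c \<in> A - {a}"
        have "f c * (p c * M c m) \<le> f m * (p c * M c m)"
          using c fm[of c] pp[of c] Mp[of c m] m by (intro mult_right_mono) auto
        then show "p' c * M c m \<le> f m * (p c * M c m)" using p'f[of c] c by (simp add: mult.assoc)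
      qed
      also have "p' a * M' a m \<le> k * p a * ((1 + e) * M a m)"
        unfolding p'a using row[of m] m(1) k pp[OF a] 
        by (intro mult_left_mono) (auto simp: algebra_simps abs_le_iff)
      also have "\<dots> = ((1 + e) * k) * (p a * M a m)" by simp
      also have "\<dots> < f m * (p a * M a m)"
        using n pp[OF a] Mp[OF a m(1)] by (intro mult_strict_right_mono) auto
      finally have "p' m < f m * (p a * M a m) + (\<Sum>c\<in>A-{a}. f m * (p c * M c m))" by simp
      also have "\<dots> = f m * p m" using eq[OF m(1)] by (simp add: distrib_left sum_distrib_left)
      finally show False using p'f[OF m(1)] by simp
    qed
    then show ?thesis using fm[OF that] by simp
  qed
  have lo: "(1 - e) * k \<le> f b" if "b \<in> A" for b
  proof -
    have "Min (f ` A) \<in> f ` A" using fin ne by simp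
    then obtain m where m: "m \<in> A" "f m = Min (f ` A)" by auto
    have fm: "f m \<le> f c" if "c \<in> A" for c using m(2) that fin by simp
    have "(1 - e) * k \<le> f m"
    proof (rule ccontr)
      assume n: "\<not> (1 - e) * k \<le> f m"
      have "f m * p m = f m * (p a * M a m) + (\<Sum>c\<in>A-{a}. f m * (p c * M c m))"
        using eq[OF m(1)] by (simp add: distrib_left sum_distrib_left)
      also have "(\<Sum>c\<in>A-{a}. f m * (p c * M c m)) \<le> (\<Sum>c\<in>A-{a}. p' c * M c m)"
      proof (intro sum_mono)
        fix c assume c: "c \<in> A - {a}"
        have "f m * (p c * M c m) \<le> f c * (p c * M c m)"
          using c fm[of c] pp[of c] Mp[of c m] m by (intro mult_right_mono) auto
        then show "f m * (p c * M c m) \<le> p' c * M c m" using p'f[of c] c by (simp add: mult.assoc)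
      qed
      also have "f m * (p a * M a m) < ((1 - e) * k) * (p a * M a m)"
        using n pp[OF a] Mp[OF a m(1)] by (intro mult_strict_right_mono) auto
      also have "\<dots> = k * p a * ((1 - e) * M a m)" by simp
      also have "\<dots> \<le> p' a * M' a m"
        unfolding p'a using row[of m] m(1) k pp[OF a] 
        by (intro mult_left_mono) (auto simp: algebra_simps abs_le_iff)
      finally have "f m * p m < p' a * M' a m + (\<Sum>c\<in>A-{a}. p' c * M c m)" by simp
      then show False using p'f[OF m(1)] eq'[OF m(1)] by simp
    qed
    then show ?thesis using fm[OF that] by simp
  qed
  \<comment> \<open>The \<open>p\<close>-average of \<open>f\<close> is 1, so 1 lies between the
    same two bounds as every \<open>f b\<close>. Hence
    \<open>\<bar>f b - 1\<bar> \<le> 2 * e * k\<close>, and \<open>e \<le> 1/2\<close> forces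
    \<open>k \<le> 2\<close>: this is the constant 4.\<close>
  have "1 \<ge> (1 - e) * k"
  proof -
    have "(\<Sum>b\<in>A. (1 - e) * k * p b) \<le> (\<Sum>b\<in>A. p' b)"
      using lo pp p'f by (intro sum_mono) (simp add: less_imp_le mult_right_mono)
    then show ?thesis by (simp add: s s' flip: sum_distrib_left)
  qed
  moreover have "1 \<le> (1 + e) * k"
  proof -
    have "(\<Sum>b\<in>A. p' b) \<le> (\<Sum>b\<in>A. (1 + e) * k * p b)"
      using up pp p'f by (intro sum_mono) (simp add: less_imp_le mult_right_mono)
    then show ?thesis by (simp add: s s' flip: sum_distrib_left)
  qed
  moreover have "e * k \<le> 1/2 * k" using e k by (intro mult_right_mono) auto
  ultimately have k2: "k \<le> 2" by (simp add: algebra_simps)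
  have f1: "\<bar>f b - 1\<bar> \<le> 4 * e" if "b \<in> A" for b
  proof -
    have "e * k \<le> e * 2" using k2 e0 by (rule mult_left_mono)
    then show ?thesis using up[OF that] lo[OF that] \<open>1 \<ge> (1 - e) * k\<close> \<open>1 \<le> (1 + e) * k\<close>
      by (simp add: algebra_simps abs_le_iff)
  qed
  have "(\<Sum>b\<in>A. \<bar>p' b - p b\<bar>) \<le> (\<Sum>b\<in>A. 4 * e * p b)"
  proof (intro sum_mono)
    fix b assume b: "b \<in> A"
    have "p' b - p b = (f b - 1) * p b" using p'f[OF b] by (simp add: algebra_simps)
    then have "\<bar>p' b - p b\<bar> = \<bar>f b - 1\<bar> * p b" using pp[OF b] by (simp add: abs_mult)
    then show "\<bar>p' b - p b\<bar> \<le> 4 * e * p b" using f1[OF b] pp[OF b] by (simp add: mult_right_mono)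
  qed
  then show ?thesis by (simp add: s flip: sum_distrib_left)
qed

text \<open>Rows are exchanged one at a time. Each mixed matrix \<open>K B\<close> is still
  positive, so it has a stationary distribution to serve as the next stop, and every row is
  exchanged once, with its error measured against the original row of \<open>M\<close>. The claim
  \<open>main\<close> covers all stationary distributions of \<open>K B\<close>, so that
  \<open>p'\<close> itself can be taken at \<open>B = A\<close>.\<close>

lemma stationary_perturb:
  fixes M M' :: "'a \<Rightarrow> 'a \<Rightarrow> real"
  assumes fin: "finite A" and M: "pos_stochastic A M" and M': "pos_stochastic A M'"
    and p: "stationary A M p" and p': "stationary A M' p'"
    and row: "\<And>a b. a \<in> A \<Longrightarrow> b \<in> A \<Longrightarrow> \<bar>M' a b - M a b\<bar> \<le> e a * M a b"
    and e: "\<And>a. a \<in> A \<Longrightarrow> e a \<le> 1/2"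
  shows "(\<Sum>b\<in>A. \<bar>p' b - p b\<bar>) \<le> 4 * (\<Sum>a\<in>A. e a)"
proof (cases "A = {}")
  case ne: False
  define K where "K B a b = (if a \<in> B then M' a b else M a b)" for B a b
  have K: "pos_stochastic A (K B)" for B
    using M M' unfolding pos_stochastic_def K_def by (intro ballI) (case_tac "a \<in> B"; simp)
  have main: "(\<Sum>b\<in>A. \<bar>r b - p b\<bar>) \<le> 4 * (\<Sum>a\<in>B. e a)"
    if "finite B" "B \<noteq> {}" "B \<subseteq> A" "stationary A (K B) r" for B r
    using that
  proof (induction B arbitrary: r rule: finite_ne_induct)
    case (singleton x)
    show ?case
      using stationary_one_row[OF fin M K[of "{x}"] p singleton(2), of x "e x"] singleton row e
      by (auto simp: K_def)
  next
    case (insert x B)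
    obtain t where t: "stationary A (K B) t" using stationary_exists[OF fin ne K] by blast
    have "(\<Sum>b\<in>A. \<bar>r b - t b\<bar>) \<le> 4 * e x"
      using insert row e
      by (intro stationary_one_row[OF fin K[of B] K[of "insert x B"] t insert.prems(2), of x "e x"])
         (auto simp: K_def)
    moreover have "(\<Sum>b\<in>A. \<bar>t b - p b\<bar>) \<le> 4 * (\<Sum>a\<in>B. e a)" using insert t by auto
    moreover have "(\<Sum>b\<in>A. \<bar>r b - p b\<bar>) \<le> (\<Sum>b\<in>A. \<bar>r b - t b\<bar> + \<bar>t b - p b\<bar>)"
      by (intro sum_mono) auto
    ultimately show ?case using insert by (simp add: sum.distrib)
  qed
  have "stationary A (K A) p'"
    using p' by (auto simp: stationary_def K_def cong: sum.cong)
  then show ?thesis using main[of A p'] fin ne by simp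
qed simp

section \<open>Regret of optimistic FTRL with the log-barrier\<close>

text \<open>The potential is the regularised value of \<open>q t\<close> against the past utilities, without the
  optimistic term; the optimistic terms telescope against the updates.\<close>
lemma oftrl_regret:
  fixes q v :: "nat \<Rightarrow> 'a \<Rightarrow> real" and w :: "nat \<Rightarrow> real"
  assumes fin: "finite A" and eta: "\<eta> > 0" and T: "T \<ge> 1"
    and wpos: "\<And>j. 1 \<le> j \<Longrightarrow> j \<le> T \<Longrightarrow> 0 < w j"
    and wmono: "\<And>j. 1 \<le> j \<Longrightarrow> j < T \<Longrightarrow> w j \<le> w (Suc j)"
    and arg: "\<And>t. 1 \<le> t \<Longrightarrow> t \<le> T \<Longrightarrow> is_lb_argmax A
        (\<lambda>b. \<eta> * ((\<Sum>j\<in>{1..<t}. w j * v j b) + w t * v (t - 1) b) / w t) (q t)"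
    and v0: "\<And>b. b \<in> A \<Longrightarrow> v 0 b = 0"
    and x: "x \<in> prob_simplex A" and xpos: "\<And>b. b \<in> A \<Longrightarrow> 0 < x b"
  shows "(\<Sum>j\<in>{1..T}. w j * (\<Sum>b\<in>A. (x b - q j b) * v j b))
     \<le> w T / \<eta> * (- (\<Sum>b\<in>A. ln (real (card A) * x b)))
       + w T * (\<Sum>b\<in>A. (x b - q T b) * (v T b - v (T - 1) b))
       + (\<Sum>j\<in>{1..<T}. w j * (\<Sum>b\<in>A. (q (Suc j) b - q j b) * (v j b - v (j - 1) b))
           - w j / \<eta> * (\<Sum>b\<in>A. q (Suc j) b / q j b - 1 - ln (q (Suc j) b / q j b)))"
proof -
  have ne: "A \<noteq> {}" using x by (auto simp: prob_simplex_def)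
  then have n: "real (card A) > 0" using fin by (simp add: card_gt_0_iff)
  have qs: "q t \<in> prob_simplex A" and qpos: "\<forall>b\<in>A. 0 < q t b" if "1 \<le> t" "t \<le> T" for t
    using arg[OF that] by (auto simp: is_lb_argmax_def)
  define R where "R y = - (\<Sum>b\<in>A. ln (real (card A) * y b))" for y :: "'a \<Rightarrow> real"
  define L where "L t b = (\<Sum>j\<in>{1..<t}. w j * v j b)" for t b
  define ip where "ip y z = (\<Sum>b\<in>A. y b * z b)" for y z :: "'a \<Rightarrow> real"
  define K where "K t = ip (q t) (L t) - w t / \<eta> * R (q t)" for t
  define D where "D y t = (\<Sum>b\<in>A. y b / q t b - 1 - ln (y b / q t b))" for y t
  have lnR: "(\<Sum>b\<in>A. ln (y b)) = - R y - real (card A) * ln (real (card A))"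
    if "\<forall>b\<in>A. 0 < y b" for y
    using that n by (simp add: R_def ln_mult_pos sum.distrib)
  have R0: "0 \<le> R y" if "y \<in> prob_simplex A" "\<forall>b\<in>A. 0 < y b" for y
    using log_barrier_nonneg[OF fin that(1)] that(2) by (simp add: R_def)
  \<comment> \<open>This is \<open>log_barrier_gap\<close> scaled by \<open>w t / \<eta>\<close>;
    the constant from normalising the barrier cancels between \<open>q t\<close> and
    \<open>y\<close>.\<close>
  have key: "K t + w t * ip (q t) (v (t - 1))
      = ip y (L t) + w t * ip y (v (t - 1)) - w t / \<eta> * R y + w t / \<eta> * D y t"
    if t: "1 \<le> t" "t \<le> T" and y: "y \<in> prob_simplex A" "\<forall>b\<in>A. 0 < y b" for t y
  proof -
    have obj: "lb_obj A (\<lambda>b. \<eta> * ((\<Sum>j\<in>{1..<t}. w j * v j b) + w t * v (t - 1) b) / w t) z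
       = \<eta> / w t * (ip z (L t) + w t * ip z (v (t - 1))) - R z - real (card A) * ln (real (card A))"
      if "\<forall>b\<in>A. 0 < z b" for z
    proof -
      have "(\<Sum>b\<in>A. z b * (\<eta> * (L t b + w t * v (t - 1) b) / w t))
          = (\<Sum>b\<in>A. \<eta> / w t * (z b * L t b) + \<eta> / w t * (w t * (z b * v (t - 1) b)))"
        using wpos[OF t] by (intro sum.cong) (auto simp: field_simps)
      also have "\<dots> = \<eta> / w t * (ip z (L t) + w t * ip z (v (t - 1)))"
        by (simp only: ip_def sum.distrib distrib_left sum_distrib_left)
      finally show ?thesis unfolding lb_obj_def L_def[symmetric] lnR[of z, OF that] by simp
    qed
    have "\<eta> / w t * (ip (q t) (L t) + w t * ip (q t) (v (t - 1))) - R (q t)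
       - (\<eta> / w t * (ip y (L t) + w t * ip y (v (t - 1))) - R y) = D y t"
      using log_barrier_gap[OF fin arg[OF t] y(1)] y(2) obj[of y, OF y(2)] obj[of "q t", OF qpos[OF t]] by (simp add: D_def)
    moreover have cancel: "u - w t / \<eta> * c - (u' - w t / \<eta> * c')
        = w t / \<eta> * (\<eta> / w t * u - c - (\<eta> / w t * u' - c'))" for u u' c c'
      using wpos[OF t] eta by (simp add: field_simps)
    ultimately have "ip (q t) (L t) + w t * ip (q t) (v (t - 1)) - w t / \<eta> * R (q t)
        - (ip y (L t) + w t * ip y (v (t - 1)) - w t / \<eta> * R y) = w t / \<eta> * D y t"
      by (simp only: cancel)
    then show ?thesis by (simp add: K_def)
  qed
  define E where "E j = w j * ip (\<lambda>b. q (Suc j) b - q j b) (\<lambda>b. v j b - v (j - 1) b)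
           - w j / \<eta> * D (q (Suc j)) j" for j
  \<comment> \<open>Take \<open>y = q (Suc t)\<close> in \<open>key\<close>. Raising the regulariser
    weight from \<open>w t\<close> to \<open>w (Suc t)\<close> only lowers the potential since
    \<open>R\<close> is nonnegative, and \<open>E t\<close> collects the error of predicting
    \<open>v t\<close> by \<open>v (t - 1)\<close> together with the divergence gained.\<close>
  have step: "K (Suc t) \<le> K t + w t * ip (q t) (v t) + E t" if t: "1 \<le> t" "t < T" for t
  proof -
    have t': "t \<le> T" "1 \<le> Suc t" "Suc t \<le> T" using t by auto
    have "w t / \<eta> * R (q (Suc t)) \<le> w (Suc t) / \<eta> * R (q (Suc t))"
      using wmono[OF t] eta R0[OF qs qpos] t' by (intro mult_right_mono divide_right_mono) auto
    moreover have "ip (q (Suc t)) (L (Suc t)) = ip (q (Suc t)) (L t) + w t * ip (q (Suc t)) (v t)"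
      using t by (simp add: ip_def L_def distrib_left sum.distrib sum_distrib_left mult_ac)
    moreover have "E t = w t * (ip (q (Suc t)) (v t) - ip (q (Suc t)) (v (t - 1)) - ip (q t) (v t)
         + ip (q t) (v (t - 1))) - w t / \<eta> * D (q (Suc t)) t"
      unfolding E_def ip_def by (simp add: algebra_simps sum.distrib sum_subtractf)
    ultimately show ?thesis
      using key[OF t(1) t'(1) qs[OF t'(2,3)] qpos[OF t'(2,3)]]
      by (simp add: K_def[of "Suc t"] algebra_simps)
  qed
  have "K t \<le> (\<Sum>j\<in>{1..<t}. w j * ip (q j) (v j) + E j)" if "1 \<le> t" "t \<le> T" for t
    using that
  proof (induction t rule: nat_induct_at_least)
    case base
    have "0 \<le> R (q 1)" using qs[of 1] qpos[of 1] T by (intro R0) auto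
    then show ?case using wpos[of 1] T eta by (simp add: K_def L_def ip_def)
  next
    case (Suc t)
    then show ?case using step[of t] by simp
  qed
  then have KT: "K T \<le> (\<Sum>j\<in>{1..<T}. w j * ip (q j) (v j) + E j)" using T by simp
  have "0 \<le> x b / q T b - 1 - ln (x b / q T b)" if "b \<in> A" for b
  proof -
    have "0 < x b / q T b" using that xpos qpos[of T] T by simp
    then show ?thesis using ln_le_minus_one by fastforce
  qed
  then have "0 \<le> D x T" unfolding D_def by (intro sum_nonneg) auto
  then have "0 \<le> w T / \<eta> * D x T" using wpos[of T] T eta by simp
  then have end': "ip x (L T) + w T * ip x (v (T - 1)) - w T / \<eta> * R x
      \<le> K T + w T * ip (q T) (v (T - 1))"
    using key[of T x] T x xpos by simp
  have xL: "ip x (L T) = (\<Sum>j\<in>{1..<T}. w j * ip x (v j))"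
    unfolding ip_def L_def sum_distrib_left by (subst sum.swap) (simp add: mult_ac)
  have "(\<Sum>j\<in>{1..T}. w j * (\<Sum>b\<in>A. (x b - q j b) * v j b))
      = (\<Sum>j\<in>{1..T}. w j * (ip x (v j) - ip (q j) (v j)))"
    by (simp add: ip_def left_diff_distrib sum_subtractf)
  also have "\<dots> = (\<Sum>j\<in>{1..<T}. w j * (ip x (v j) - ip (q j) (v j)))
      + w T * (ip x (v T) - ip (q T) (v T))"
  proof -
    have "{1..T} = insert T {1..<T}" using T by auto
    then show ?thesis by simp
  qed
  also have "\<dots> = ip x (L T) - (\<Sum>j\<in>{1..<T}. w j * ip (q j) (v j))
      + w T * (ip x (v T) - ip (q T) (v T))"
    by (simp add: xL right_diff_distrib sum_subtractf)
  also have "\<dots> \<le> w T / \<eta> * R x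
     + w T * (ip x (v T) - ip (q T) (v T) - (ip x (v (T - 1)) - ip (q T) (v (T - 1))))
     + (\<Sum>j\<in>{1..<T}. E j)"
    using KT end' by (simp add: sum.distrib algebra_simps)
  also have "ip x (v T) - ip (q T) (v T) - (ip x (v (T - 1)) - ip (q T) (v (T - 1)))
     = (\<Sum>b\<in>A. (x b - q T b) * (v T b - v (T - 1) b))"
    by (simp add: ip_def algebra_simps sum.distrib sum_subtractf)
  finally show ?thesis unfolding R_def E_def D_def ip_def .
qed

lemma sum_mult_le_simplex:
  assumes "x \<in> prob_simplex A" "\<And>b. b \<in> A \<Longrightarrow> \<bar>f b\<bar> \<le> (c :: real)"
  shows "\<bar>\<Sum>b\<in>A. x b * f b\<bar> \<le> c"
proof -
  have "\<bar>\<Sum>b\<in>A. x b * f b\<bar> \<le> (\<Sum>b\<in>A. x b * c)"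
    using assms by (intro order_trans[OF sum_abs] sum_mono)
      (auto simp: abs_mult prob_simplex_def intro!: mult_left_mono)
  also have "\<dots> = c" using assms by (simp add: prob_simplex_def flip: sum_distrib_right)
  finally show ?thesis .
qed

text \<open>The divergence supplies \<open>(z - 1)\<^sup>2 / (3 * \<eta>)\<close> per coordinate.
  Half of it absorbs the prediction error by Young's inequality, the other half survives as the
  negative term. Keeping one factor \<open>q j b\<close> in the error lets it sum to 1 over the
  actions, so \<open>\<beta>\<close> enters without a cardinality. The last round has no successor
  to supply a negative term and is charged to \<open>\<gamma>\<close>.\<close>

lemma oftrl_log_barrier_regret:
  fixes q v :: "nat \<Rightarrow> 'a \<Rightarrow> real" and w :: "nat \<Rightarrow> real"
  assumes fin: "finite A" and eta: "\<eta> > 0" and T: "T \<ge> 1"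
    and wpos: "\<And>j. 1 \<le> j \<Longrightarrow> j \<le> T \<Longrightarrow> 0 < w j"
    and wmono: "\<And>j. 1 \<le> j \<Longrightarrow> j < T \<Longrightarrow> w j \<le> w (Suc j)"
    and arg: "\<And>t. 1 \<le> t \<Longrightarrow> t \<le> T \<Longrightarrow> is_lb_argmax A
        (\<lambda>b. \<eta> * ((\<Sum>j\<in>{1..<t}. w j * v j b) + w t * v (t - 1) b) / w t) (q t)"
    and v0: "\<And>b. b \<in> A \<Longrightarrow> v 0 b = 0"
    and stable: "\<And>j b. 1 \<le> j \<Longrightarrow> j < T \<Longrightarrow> b \<in> A \<Longrightarrow> \<bar>q (Suc j) b / q j b - 1\<bar> \<le> 1 / 2"
    and \<beta>: "\<And>j b. 1 \<le> j \<Longrightarrow> j < T \<Longrightarrow> b \<in> A \<Longrightarrow> \<bar>v j b - v (j - 1) b\<bar> \<le> \<beta> j"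
    and \<gamma>: "\<And>b. b \<in> A \<Longrightarrow> \<bar>v T b - v (T - 1) b\<bar> \<le> \<gamma>"
    and x: "x \<in> prob_simplex A" and xpos: "\<And>b. b \<in> A \<Longrightarrow> 0 < x b"
  shows "(\<Sum>j\<in>{1..T}. w j * (\<Sum>b\<in>A. (x b - q j b) * v j b))
     \<le> w T / \<eta> * (- (\<Sum>b\<in>A. ln (real (card A) * x b))) + 2 * \<gamma> * w T
       + (\<Sum>j\<in>{1..<T}. w j * (3 * \<eta> / 2 * (\<beta> j)\<^sup>2
            - 1 / (6 * \<eta>) * (\<Sum>b\<in>A. (q (Suc j) b / q j b - 1)\<^sup>2)))"
proof -
  have qs: "q t \<in> prob_simplex A" and qpos: "\<forall>b\<in>A. 0 < q t b" if "1 \<le> t" "t \<le> T" for t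
    using arg[OF that] by (auto simp: is_lb_argmax_def)
  have "(\<Sum>b\<in>A. (x b - q T b) * (v T b - v (T - 1) b)) \<le> 2 * \<gamma>"
    using sum_mult_le_simplex[OF x, of "\<lambda>b. v T b - v (T - 1) b" \<gamma>]
      sum_mult_le_simplex[OF qs[of T], of "\<lambda>b. v T b - v (T - 1) b" \<gamma>] T \<gamma>
    by (simp add: left_diff_distrib sum_subtractf abs_le_iff)
  then have 1: "w T * (\<Sum>b\<in>A. (x b - q T b) * (v T b - v (T - 1) b)) \<le> 2 * \<gamma> * w T"
    using wpos[of T] T by (simp add: mult.commute mult_right_mono)
  have 2: "w j * (\<Sum>b\<in>A. (q (Suc j) b - q j b) * (v j b - v (j - 1) b))
           - w j / \<eta> * (\<Sum>b\<in>A. q (Suc j) b / q j b - 1 - ln (q (Suc j) b / q j b))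
       \<le> w j * (3 * \<eta> / 2 * (\<beta> j)\<^sup>2 - 1 / (6 * \<eta>) * (\<Sum>b\<in>A. (q (Suc j) b / q j b - 1)\<^sup>2))"
    if j: "j \<in> {1..<T}" for j
  proof -
    define z where "z b = q (Suc j) b / q j b" for b
    have j': "1 \<le> j" "j \<le> T" "j < T" using j by auto
    have arith: "u - k \<le> s - y"
      if "u \<le> y + r" "r \<le> s" "m \<le> k" "m = 2 * y" for u y r s m k :: real
      using that by linarith
    have "(q (Suc j) b - q j b) * (v j b - v (j - 1) b) - 1 / \<eta> * (z b - 1 - ln (z b))
        \<le> q j b * (3 * \<eta> / 2 * (\<beta> j)\<^sup>2) - 1 / (6 * \<eta>) * (z b - 1)\<^sup>2" if b: "b \<in> A" for b
    proof -
      define d where "d = v j b - v (j - 1) b"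
      have qb: "0 < q j b" "q j b \<le> 1"
        using bspec[OF qpos[OF j'(1,2)] b] qs[OF j'(1,2)] member_le_sum[of b A "q j"] b fin
        by (auto simp: prob_simplex_def)
      have dq: "q (Suc j) b - q j b = q j b * (z b - 1)"
        using qb by (simp add: z_def algebra_simps)
      have "0 \<le> (z b - 1 - 3 * \<eta> * (q j b * d))\<^sup>2 / (6 * \<eta>)" using eta by simp
      also have "\<dots> = 1 / (6 * \<eta>) * (z b - 1)\<^sup>2 - q j b * (z b - 1) * d + 3 * \<eta> / 2 * (q j b * d)\<^sup>2"
        using eta by (simp add: power2_eq_square field_simps)
      finally have yg: "q j b * (z b - 1) * d \<le> 1 / (6 * \<eta>) * (z b - 1)\<^sup>2 + 3 * \<eta> / 2 * (q j b * d)\<^sup>2"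
        by simp
      have "d\<^sup>2 \<le> (\<beta> j)\<^sup>2"
        using \<beta>[OF j'(1,3) b] by (simp add: d_def abs_le_square_iff[symmetric])
      then have "q j b * q j b * d\<^sup>2 \<le> q j b * 1 * (\<beta> j)\<^sup>2"
        using qb by (intro mult_mono) auto
      then have sq: "3 * \<eta> / 2 * (q j b * d)\<^sup>2 \<le> q j b * (3 * \<eta> / 2 * (\<beta> j)\<^sup>2)"
        using eta by (simp add: power2_eq_square mult_ac)
      have "1 / \<eta> * ((z b - 1)\<^sup>2 / 3) \<le> 1 / \<eta> * (z b - 1 - ln (z b))"
        using minus_ln_quadratic[of "z b"] stable[OF j'(1,3) b] eta
        by (intro mult_left_mono) (auto simp: z_def)
      moreover have "1 / \<eta> * ((z b - 1)\<^sup>2 / 3) = 2 * (1 / (6 * \<eta>) * (z b - 1)\<^sup>2)" by simp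
      ultimately show ?thesis
        unfolding dq d_def[symmetric]
        using arith[OF yg sq] by blast
    qed
    then have "(\<Sum>b\<in>A. (q (Suc j) b - q j b) * (v j b - v (j - 1) b)) - (\<Sum>b\<in>A. 1 / \<eta> * (z b - 1 - ln (z b)))
      \<le> (\<Sum>b\<in>A. q j b * (3 * \<eta> / 2 * (\<beta> j)\<^sup>2)) - (\<Sum>b\<in>A. 1 / (6 * \<eta>) * (z b - 1)\<^sup>2)"
      unfolding sum_subtractf[symmetric] by (rule sum_mono)
    then have "(\<Sum>b\<in>A. (q (Suc j) b - q j b) * (v j b - v (j - 1) b)) - 1 / \<eta> * (\<Sum>b\<in>A. z b - 1 - ln (z b))
      \<le> (\<Sum>b\<in>A. q j b) * (3 * \<eta> / 2 * (\<beta> j)\<^sup>2) - 1 / (6 * \<eta>) * (\<Sum>b\<in>A. (z b - 1)\<^sup>2)"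
      by (simp only: sum_distrib_left sum_distrib_right)
    moreover have "(\<Sum>b\<in>A. q j b) = 1" using qs[OF j'(1,2)] by (simp add: prob_simplex_def)
    ultimately have "w j * ((\<Sum>b\<in>A. (q (Suc j) b - q j b) * (v j b - v (j - 1) b))
         - 1 / \<eta> * (\<Sum>b\<in>A. z b - 1 - ln (z b)))
      \<le> w j * (3 * \<eta> / 2 * (\<beta> j)\<^sup>2 - 1 / (6 * \<eta>) * (\<Sum>b\<in>A. (z b - 1)\<^sup>2))"
      using wpos[OF j'(1,2)] by (intro mult_left_mono) auto
    then show ?thesis by (simp only: z_def right_diff_distrib times_divide_eq_right mult.assoc[symmetric] mult_1_right)
  qed
  show ?thesis
    by (rule order_trans[OF oftrl_regret[where w = w and \<eta> = \<eta>]])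
      (use assms in \<open>auto intro!: add_mono 1[simplified] sum_mono[OF 2, simplified]\<close>)
qed

section \<open>The averaging weights\<close>

lemma one_minus_alpha: "t \<ge> 1 \<Longrightarrow> 1 - alpha H t = (real t - 1) / (real H + real t)"
  by (simp add: alpha_def field_simps)

lemma alpha_pos: "t \<ge> 1 \<Longrightarrow> 0 < alpha H t"
  by (simp add: alpha_def)

lemma alpha_le_one: "t \<ge> 1 \<Longrightarrow> alpha H t \<le> 1"
  by (simp add: alpha_def)

lemma alpha_one: "alpha H 1 = 1"
  by (simp add: alpha_def)

lemma alpha_w_self: "alpha_w H t t = alpha H t"
  by (simp add: alpha_w_def)

lemma alpha_w_Suc: "j \<le> t \<Longrightarrow> alpha_w H (Suc t) j = (1 - alpha H (Suc t)) * alpha_w H t j"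
  by (simp add: alpha_w_def prod.cl_ivl_Suc)

lemma alpha_w_pos:
  assumes "1 \<le> j" "j \<le> t"
  shows "0 < alpha_w H t j"
  using assms(2)
proof (induction t rule: dec_induct)
  case base
  then show ?case using assms(1) by (simp add: alpha_w_self alpha_pos)
next
  case (step t)
  then show ?case using assms(1) one_minus_alpha[of "Suc t" H] by (simp add: alpha_w_Suc)
qed

lemma sum_alpha_w_Suc:
  "(\<Sum>j\<in>{1..Suc t}. alpha_w H (Suc t) j * f j)
     = (1 - alpha H (Suc t)) * (\<Sum>j\<in>{1..t}. alpha_w H t j * f j) + alpha H (Suc t) * f (Suc t)"
  by (simp add: alpha_w_Suc alpha_w_self sum_distrib_left mult.assoc)

lemma sum_alpha_w: "t \<ge> 1 \<Longrightarrow> (\<Sum>j\<in>{1..t}. alpha_w H t j) = 1"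
proof (induction t rule: nat_induct_at_least)
  case base
  then show ?case by (simp add: alpha_w_self alpha_one[simplified])
next
  case (Suc t)
  then show ?case using sum_alpha_w_Suc[of H t "\<lambda>_. 1"] by simp
qed

text \<open>The right-hand side satisfies the recursion of \<open>sum_alpha_w_Suc\<close> with
  equality, so the induction loses only at \<open>t = 1\<close>, where 1 is replaced by 1 +
  1/H.\<close>

lemma sum_alpha_w_inverse:
  assumes "H \<ge> 1" "t \<ge> 1"
  shows "(\<Sum>j\<in>{1..t}. alpha_w H t j * (1 / real j)) \<le> (1 + 1 / real H) / real t"
  using assms(2)
proof (induction t rule: nat_induct_at_least)
  case base
  then show ?case by (simp add: alpha_w_self alpha_one[simplified])
next
  case (Suc t)
  have "(1 - alpha H (Suc t)) * (\<Sum>j\<in>{1..t}. alpha_w H t j * (1 / real j))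
     \<le> (1 - alpha H (Suc t)) * ((1 + 1 / real H) / real t)"
    using Suc alpha_le_one[of "Suc t" H] by (intro mult_left_mono) auto
  also have "\<dots> + alpha H (Suc t) * (1 / real (Suc t)) = (1 + 1 / real H) / real (Suc t)"
    using assms(1) Suc.hyps one_minus_alpha[of "Suc t" H]
    by (simp add: alpha_def divide_simps) (simp add: algebra_simps)
  finally show ?case unfolding sum_alpha_w_Suc by simp
qed

lemma wgt_Suc_left: "1 \<le> j \<Longrightarrow> j \<le> t \<Longrightarrow> wgt H (Suc t) j = wgt H t j"
  using one_minus_alpha[of "Suc t" H] by (simp add: wgt_def alpha_w_Suc)

text \<open>Both \<open>alpha_w H t j\<close> and \<open>alpha_w H t 1\<close> gain the same factor
  in each later round, so their ratio is fixed. All rounds thus use one weight sequence, as the FTRL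
  analysis requires.\<close>

lemma wgt_eq_diag: "1 \<le> j \<Longrightarrow> j \<le> t \<Longrightarrow> wgt H t j = wgt H j j"
  by (rotate_tac 1, induction t rule: dec_induct) (auto simp: wgt_Suc_left)

lemma wgt_pos: "1 \<le> j \<Longrightarrow> j \<le> t \<Longrightarrow> 0 < wgt H t j"
  by (simp add: wgt_def alpha_w_pos)

lemma alpha_w_eq_wgt:
  assumes "1 \<le> j" "j \<le> t"
  shows "alpha_w H t 1 * wgt H j j = alpha_w H t j"
proof -
  have "alpha_w H t 1 * wgt H t j = alpha_w H t j"
    using assms alpha_w_pos[of 1 t H] by (simp add: wgt_def)
  then show ?thesis by (simp only: wgt_eq_diag[OF assms])
qed

lemma wgt_diag_Suc:
  assumes "1 \<le> j"
  shows "wgt H (Suc j) (Suc j) = wgt H j j * ((real H + real j) / real j)"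
  using assms alpha_w_pos[of 1 j H] one_minus_alpha[of "Suc j" H]
  by (simp add: wgt_def alpha_w_Suc alpha_w_self alpha_def divide_simps)

section \<open>Product distributions\<close>

lemma sum_PiE_insert:
  assumes "i \<notin> I"
  shows "(\<Sum>b\<in>PiE (insert i I) A. f b) = (\<Sum>x\<in>A i. \<Sum>b\<in>PiE I A. f (b(i := x)))"
proof -
  have "(\<Sum>b\<in>PiE (insert i I) A. f b) = (\<Sum>(x, b)\<in>A i \<times> PiE I A. f (b(i := x)))"
    unfolding PiE_insert_eq using assms
    by (subst sum.reindex[OF inj_combinator]) (auto simp: case_prod_unfold)
  then show ?thesis by (simp add: sum.cartesian_product)
qed

lemma sum_PiE_prod_simplex:
  fixes p :: "'i \<Rightarrow> 'a \<Rightarrow> real"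
  assumes "finite I" "\<And>k. k \<in> I \<Longrightarrow> p k \<in> prob_simplex (A k)"
  shows "(\<Sum>b\<in>PiE I A. \<Prod>k\<in>I. p k (b k)) = 1"
proof -
  have 1: "(\<Sum>x\<in>A k. p k x) = 1" if "k \<in> I" for k using assms(2)[OF that] by (simp add: prob_simplex_def)
  then have "finite (A k)" if "k \<in> I" for k using that sum.infinite by fastforce
  then show ?thesis using assms(1) 1 by (simp flip: prod_sum_PiE)
qed

lemma prod_simplex_nonneg:
  fixes p :: "'i \<Rightarrow> 'a \<Rightarrow> real"
  assumes "\<And>k. k \<in> I \<Longrightarrow> p k \<in> prob_simplex (A k)" "b \<in> PiE I A"
  shows "0 \<le> (\<Prod>k\<in>I. p k (b k))"
proof (rule prod_nonneg)
  fix k assume k: "k \<in> I"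
  then show "0 \<le> p k (b k)" using assms(1)[OF k] PiE_mem[OF assms(2) k] by (simp add: prob_simplex_def)
qed

text \<open>Total variation is subadditive over products: write p X - q Y = (p - q) X + q (X - Y)
  and use that \<open>X\<close> and \<open>q i\<close> both have mass 1.\<close>

lemma sum_PiE_prod_diff:
  fixes p q :: "'i \<Rightarrow> 'a \<Rightarrow> real"
  assumes "finite I" "\<And>k. k \<in> I \<Longrightarrow> p k \<in> prob_simplex (A k)"
    "\<And>k. k \<in> I \<Longrightarrow> q k \<in> prob_simplex (A k)"
  shows "(\<Sum>b\<in>PiE I A. \<bar>(\<Prod>k\<in>I. p k (b k)) - (\<Prod>k\<in>I. q k (b k))\<bar>)
           \<le> (\<Sum>k\<in>I. \<Sum>x\<in>A k. \<bar>p k x - q k x\<bar>)"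
  using assms
proof (induction I rule: finite_induct)
  case (insert i I)
  define X where "X b = (\<Prod>k\<in>I. p k (b k))" for b
  define Y where "Y b = (\<Prod>k\<in>I. q k (b k))" for b
  have XY: "X (b(i := x)) = X b" "Y (b(i := x)) = Y b" for b x
    unfolding X_def Y_def using insert.hyps by (auto intro!: prod.cong)
  have Xn: "0 \<le> X b" if "b \<in> PiE I A" for b
    unfolding X_def using that insert.prems by (intro prod_simplex_nonneg[where p = p and A = A]) auto
  have qs: "(\<Sum>x\<in>A i. q i x) = 1" and qn: "\<And>x. x \<in> A i \<Longrightarrow> 0 \<le> q i x"
    using insert.prems(2)[of i] by (auto simp: prob_simplex_def)
  have Xs: "(\<Sum>b\<in>PiE I A. X b) = 1"
    unfolding X_def using insert by (intro sum_PiE_prod_simplex[where p = p and A = A]) auto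
  have "(\<Sum>b\<in>PiE (insert i I) A. \<bar>(\<Prod>k\<in>insert i I. p k (b k)) - (\<Prod>k\<in>insert i I. q k (b k))\<bar>)
     = (\<Sum>x\<in>A i. \<Sum>b\<in>PiE I A. \<bar>p i x * X b - q i x * Y b\<bar>)"
    using insert.hyps by (simp add: sum_PiE_insert XY flip: X_def Y_def)
  also have "\<dots> \<le> (\<Sum>x\<in>A i. \<Sum>b\<in>PiE I A. \<bar>p i x - q i x\<bar> * X b + q i x * \<bar>X b - Y b\<bar>)"
  proof (intro sum_mono)
    fix x b assume "x \<in> A i" "b \<in> PiE I A"
    have "p i x * X b - q i x * Y b = (p i x - q i x) * X b + q i x * (X b - Y b)"
      by (simp add: algebra_simps)
    also have "\<bar>\<dots>\<bar> \<le> \<bar>(p i x - q i x) * X b\<bar> + \<bar>q i x * (X b - Y b)\<bar>" by simp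
    finally show "\<bar>p i x * X b - q i x * Y b\<bar> \<le> \<bar>p i x - q i x\<bar> * X b + q i x * \<bar>X b - Y b\<bar>"
      using Xn[OF \<open>b \<in> PiE I A\<close>] qn[OF \<open>x \<in> A i\<close>] by (simp add: abs_mult)
  qed
  also have "\<dots> = (\<Sum>x\<in>A i. \<bar>p i x - q i x\<bar>) + (\<Sum>b\<in>PiE I A. \<bar>X b - Y b\<bar>)"
    by (simp add: sum.distrib Xs qs flip: sum_distrib_left sum_distrib_right)
  also have "(\<Sum>b\<in>PiE I A. \<bar>X b - Y b\<bar>) \<le> (\<Sum>k\<in>I. \<Sum>x\<in>A k. \<bar>p k x - q k x\<bar>)"
    unfolding X_def Y_def using insert by auto
  finally show ?case using insert.hyps by simp
qed simp

section \<open>Value estimates and the gap recursion\<close>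

locale bm_oftrl =
  fixes N H T :: nat
    and Act :: "nat \<Rightarrow> 'a set"
    and r :: "nat \<Rightarrow> nat \<Rightarrow> 's::finite \<Rightarrow> (nat \<Rightarrow> 'a) \<Rightarrow> real"
    and P :: "nat \<Rightarrow> 's \<Rightarrow> (nat \<Rightarrow> 'a) \<Rightarrow> 's \<Rightarrow> real"
    and pol :: "nat \<Rightarrow> nat \<Rightarrow> nat \<Rightarrow> 's \<Rightarrow> 'a \<Rightarrow> real"
    and Q :: "nat \<Rightarrow> nat \<Rightarrow> nat \<Rightarrow> 's \<Rightarrow> (nat \<Rightarrow> 'a) \<Rightarrow> real"
    and \<eta> :: real
  assumes H_ge_one: "H \<ge> 1" and T_ge_one: "T \<ge> 1"
    and Act: "\<And>i. i < N \<Longrightarrow> finite (Act i)" "\<And>i. i < N \<Longrightarrow> Act i \<noteq> {}"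
    and r01: "\<And>h i s a. h \<in> {1..H} \<Longrightarrow> i < N \<Longrightarrow> a \<in> joint N Act \<Longrightarrow> 0 \<le> r h i s a \<and> r h i s a \<le> 1"
    and P: "\<And>h s a s'. h \<in> {1..H} \<Longrightarrow> a \<in> joint N Act \<Longrightarrow> 0 \<le> P h s a s'"
      "\<And>h s a. h \<in> {1..H} \<Longrightarrow> a \<in> joint N Act \<Longrightarrow> (\<Sum>s'\<in>UNIV. P h s a s') = 1"
    and run: "bm_oftrl_run N H Act r P \<eta> T pol Q"
begin

section \<open>Played policies and the range of the value estimates\<close>

lemma Q0: "Q 0 h i s a = 0"
  and Q_last: "Q t (H + 1) i s a = 0"
  and pol0: "h \<in> {1..H} \<Longrightarrow> i < N \<Longrightarrow> x \<in> Act i \<Longrightarrow> pol 0 h i s x = 1 / real (card (Act i))"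
proof -
  have "\<forall>h i s a. Q 0 h i s a = 0" using run unfolding bm_oftrl_run_def by (elim conjE)
  then show "Q 0 h i s a = 0" by blast
  have "\<forall>t i s a. Q t (H + 1) i s a = 0" using run unfolding bm_oftrl_run_def by (elim conjE)
  then show "Q t (H + 1) i s a = 0" by blast
  have "\<forall>h\<in>{1..H}. \<forall>i<N. \<forall>s. \<forall>a\<in>Act i. pol 0 h i s a = 1 / real (card (Act i))"
    using run unfolding bm_oftrl_run_def by (elim conjE)
  then show "h \<in> {1..H} \<Longrightarrow> i < N \<Longrightarrow> x \<in> Act i \<Longrightarrow> pol 0 h i s x = 1 / real (card (Act i))" by blast
qed

lemma pol_simplex:
  assumes "t \<le> T" "h \<in> {1..H}" "i < N"
  shows "pol t h i s \<in> prob_simplex (Act i)"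
proof (cases t)
  case 0
  then show ?thesis using pol0[of h i _ s] assms Act[of i] by (simp add: prob_simplex_def)
next
  case (Suc t')
  then show ?thesis using run assms by (simp add: bm_oftrl_run_def)
qed

lemma pol_nonneg:
  "t \<le> T \<Longrightarrow> h \<in> {1..H} \<Longrightarrow> i < N \<Longrightarrow> a \<in> Act i \<Longrightarrow> 0 \<le> pol t h i s a"
  using pol_simplex[of t h i s] by (simp add: prob_simplex_def)

lemma sum_pol: "t \<le> T \<Longrightarrow> h \<in> {1..H} \<Longrightarrow> i < N \<Longrightarrow> (\<Sum>a\<in>Act i. pol t h i s a) = 1"
  using pol_simplex[of t h i s] by (simp add: prob_simplex_def)

lemma joint_weight_nonneg:
  "t \<le> T \<Longrightarrow> h \<in> {1..H} \<Longrightarrow> a \<in> joint N Act \<Longrightarrow> 0 \<le> (\<Prod>k<N. pol t h k s (a k))"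
  unfolding joint_def
  by (rule prod_simplex_nonneg[where p = "\<lambda>k. pol t h k s" and A = Act]) (simp_all add: pol_simplex)

lemma sum_joint_weight:
  "t \<le> T \<Longrightarrow> h \<in> {1..H} \<Longrightarrow> (\<Sum>a\<in>joint N Act. \<Prod>k<N. pol t h k s (a k)) = 1"
  unfolding joint_def
  by (rule sum_PiE_prod_simplex[where p = "\<lambda>k. pol t h k s"]) (simp_all add: pol_simplex)

lemma prodQ_bounds:
  assumes "t \<le> T" "h \<in> {1..H}" "\<And>a. a \<in> joint N Act \<Longrightarrow> 0 \<le> F s a \<and> F s a \<le> c"
  shows "0 \<le> prodQ N Act F (pol t h) s \<and> prodQ N Act F (pol t h) s \<le> c"
proof -
  have "prodQ N Act F (pol t h) s \<le> (\<Sum>a\<in>joint N Act. c * (\<Prod>k<N. pol t h k s (a k)))"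
    unfolding prodQ_def using assms joint_weight_nonneg[OF assms(1,2)]
    by (intro sum_mono mult_right_mono) auto
  also have "\<dots> = c" using sum_joint_weight[OF assms(1,2)] by (simp flip: sum_distrib_left)
  finally show ?thesis
    unfolding prodQ_def using assms joint_weight_nonneg[OF assms(1,2)] by (auto intro!: sum_nonneg)
qed

lemma expectation_bounds:
  fixes f :: "'s \<Rightarrow> real"
  assumes "h \<in> {1..H}" "a \<in> joint N Act" "\<And>s'. 0 \<le> f s' \<and> f s' \<le> c"
  shows "0 \<le> (\<Sum>s'\<in>UNIV. P h s a s' * f s') \<and> (\<Sum>s'\<in>UNIV. P h s a s' * f s') \<le> c"
proof -
  have "(\<Sum>s'\<in>UNIV. P h s a s' * f s') \<le> (\<Sum>s'\<in>UNIV. P h s a s' * c)"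
    using assms P(1) by (intro sum_mono mult_left_mono) auto
  also have "\<dots> = c" using P(2)[OF assms(1,2)] by (simp flip: sum_distrib_right)
  finally show ?thesis using assms P(1) by (auto intro!: sum_nonneg)
qed

definition target :: "nat \<Rightarrow> nat \<Rightarrow> nat \<Rightarrow> 's \<Rightarrow> (nat \<Rightarrow> 'a) \<Rightarrow> real" where
  "target t h i s a = r h i s a
     + (\<Sum>s'\<in>UNIV. P h s a s' * prodQ N Act (Q t (h + 1) i) (pol t (h + 1)) s')"

lemma Q_step:
  assumes "t \<in> {1..T}" "h \<in> {1..H}" "i < N" "a \<in> joint N Act"
  shows "Q t h i s a = (1 - alpha H t) * Q (t - 1) h i s a + alpha H t * target t h i s a"
proof -
  have "\<forall>t\<in>{1..T}. \<forall>h\<in>{1..H}. \<forall>i<N. \<forall>s. \<forall>a\<in>joint N Act.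
      Q t h i s a = (1 - alpha H t) * Q (t - 1) h i s a + alpha H t * target t h i s a"
    using run unfolding bm_oftrl_run_def target_def by (elim conjE)
  from this[rule_format, OF assms] show ?thesis .
qed

lemma target_bounds_aux:
  assumes "t \<le> T" "m < H" "i < N" "a \<in> joint N Act"
    and IH: "\<And>s a. a \<in> joint N Act \<Longrightarrow> 0 \<le> Q t (H + 1 - m) i s a \<and> Q t (H + 1 - m) i s a \<le> real m"
  shows "0 \<le> target t (H - m) i s a \<and> target t (H - m) i s a \<le> real (Suc m)"
proof -
  have h: "H - m \<in> {1..H}" "H - m + 1 = H + 1 - m" using assms(2) by auto
  have "0 \<le> prodQ N Act (Q t (H - m + 1) i) (pol t (H - m + 1)) s'
      \<and> prodQ N Act (Q t (H - m + 1) i) (pol t (H - m + 1)) s' \<le> real m" for s'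
  \<comment> \<open>At step \<open>H + 1\<close> the run does not constrain \<open>pol\<close> to be
    a distribution, so there the bound comes from the vanishing of \<open>Q\<close>.\<close>
  proof (cases "m = 0")
    case True
    then show ?thesis by (simp add: prodQ_def Q_last[simplified])
  next
    case False
    then show ?thesis unfolding h(2) using assms by (intro prodQ_bounds IH) auto
  qed
  then have "0 \<le> (\<Sum>s'\<in>UNIV. P (H - m) s a s' * prodQ N Act (Q t (H - m + 1) i) (pol t (H - m + 1)) s')
      \<and> (\<Sum>s'\<in>UNIV. P (H - m) s a s' * prodQ N Act (Q t (H - m + 1) i) (pol t (H - m + 1)) s') \<le> real m"
    by (intro expectation_bounds h(1) assms(4)) auto
  then show ?thesis
    using r01[OF h(1) assms(3,4), of s] unfolding target_def by simp
qed

text \<open>\<open>Q t h\<close> is built from \<open>Q (t - 1) h\<close> and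
  \<open>Q t (h + 1)\<close>, hence an outer induction on the round and an inner one on
  \<open>m\<close>, the number of steps left to play.\<close>

lemma Q_bounds_aux:
  assumes "i < N" "a \<in> joint N Act" "t \<le> T" "m \<le> H"
  shows "0 \<le> Q t (H + 1 - m) i s a \<and> Q t (H + 1 - m) i s a \<le> real m"
  using assms(2-)
proof (induction t arbitrary: m s a)
  case 0
  then show ?case by (simp add: Q0)
next
  case (Suc t)
  note outer = Suc.IH
  show ?case using Suc.prems
  proof (induction m arbitrary: s a)
    case 0
    then show ?case using Q_last by simp
  next
    case (Suc m)
    have h: "H - m \<in> {1..H}" "H + 1 - Suc m = H - m" using Suc.prems by auto
    have t: "Suc t \<in> {1..T}" using Suc.prems by simp
    have x: "0 \<le> target (Suc t) (H - m) i s a \<and> target (Suc t) (H - m) i s a \<le> real (Suc m)"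
      using Suc by (intro target_bounds_aux assms(1)) auto
    have y: "0 \<le> Q t (H - m) i s a \<and> Q t (H - m) i s a \<le> real (Suc m)"
      using outer[of a "Suc m" s] Suc.prems h(2) by simp
    have al: "0 \<le> alpha H (Suc t)" "alpha H (Suc t) \<le> 1"
      using alpha_pos[of "Suc t" H] alpha_le_one[of "Suc t" H] by auto
    have "(1 - alpha H (Suc t)) * Q t (H - m) i s a + alpha H (Suc t) * target (Suc t) (H - m) i s a
        \<le> (1 - alpha H (Suc t)) * real (Suc m) + alpha H (Suc t) * real (Suc m)"
      using x y al by (intro add_mono mult_left_mono) auto
    also have "\<dots> = real (Suc m)" by (simp add: left_diff_distrib)
    finally have "Q (Suc t) (H - m) i s a \<le> real (Suc m)"
      using Q_step[OF t h(1) assms(1) Suc.prems(1), of s] by simp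
    moreover have "0 \<le> Q (Suc t) (H - m) i s a"
      using Q_step[OF t h(1) assms(1) Suc.prems(1), of s] x y al by simp
    ultimately show ?case unfolding h(2) by simp
  qed
qed

lemma Q_bounds:
  assumes "t \<le> T" "h \<in> {1..H}" "i < N" "a \<in> joint N Act"
  shows "0 \<le> Q t h i s a" "Q t h i s a \<le> real H"
proof -
  have h: "H + 1 - (H + 1 - h) = h" "H + 1 - h \<le> H" "real (H + 1 - h) \<le> real H" using assms by auto
  show "0 \<le> Q t h i s a" "Q t h i s a \<le> real H"
    using Q_bounds_aux[OF assms(3,4,1) h(2), of s] h(3) unfolding h(1) by auto
qed

lemma target_bounds:
  assumes "t \<le> T" "h \<in> {1..H}" "i < N" "a \<in> joint N Act"
  shows "0 \<le> target t h i s a" "target t h i s a \<le> real H"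
proof -
  have "0 \<le> target t (H - (H - h)) i s a \<and> target t (H - (H - h)) i s a \<le> real (Suc (H - h))"
    using assms by (intro target_bounds_aux Q_bounds_aux) auto
  moreover have "H - (H - h) = h" using assms by auto
  moreover have "real (Suc (H - h)) \<le> real H" using assms by auto
  ultimately show "0 \<le> target t h i s a" "target t h i s a \<le> real H" by auto
qed

lemma Q_diff:
  assumes "t \<in> {1..T}" "h \<in> {1..H}" "i < N" "a \<in> joint N Act"
  shows "\<bar>Q t h i s a - Q (t - 1) h i s a\<bar> \<le> alpha H t * real H"
proof -
  have "Q t h i s a - Q (t - 1) h i s a = alpha H t * (target t h i s a - Q (t - 1) h i s a)"
    unfolding Q_step[OF assms] by (simp add: algebra_simps)
  moreover have "\<bar>target t h i s a - Q (t - 1) h i s a\<bar> \<le> real H"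
  proof -
    have t: "t \<le> T" "t - 1 \<le> T" using assms(1) by auto
    show ?thesis
      using target_bounds[OF t(1) assms(2-4), of s] Q_bounds[OF t(2) assms(2-4), of s] by linarith
  qed
  ultimately show ?thesis using alpha_pos[of t H] assms(1)
    by (simp add: abs_mult mult_left_mono)
qed

section \<open>Variation of an agent's utilities between rounds\<close>

definition util :: "nat \<Rightarrow> nat \<Rightarrow> nat \<Rightarrow> 's \<Rightarrow> 'a \<Rightarrow> real" where
  "util t h i s b = prodQ_minus N Act (Q t h i) (pol t h) i s b"

definition drift :: "nat \<Rightarrow> nat \<Rightarrow> nat \<Rightarrow> 's \<Rightarrow> real" where
  "drift t h k s = (\<Sum>x\<in>Act k. \<bar>pol t h k s x - pol (t - 1) h k s x\<bar>)"

lemma upd_joint: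
  assumes "b \<in> PiE ({..<N} - {i}) Act" "i < N" "x \<in> Act i"
  shows "b(i := x) \<in> joint N Act"
  using PiE_fun_upd[OF assms(3,1)] assms(2) by (simp add: joint_def insert_absorb)

lemma minus_weight_nonneg:
  "t \<le> T \<Longrightarrow> h \<in> {1..H} \<Longrightarrow> b \<in> PiE ({..<N} - {i}) Act
    \<Longrightarrow> 0 \<le> (\<Prod>k\<in>{..<N} - {i}. pol t h k s (b k))"
  by (rule prod_simplex_nonneg[where p = "\<lambda>k. pol t h k s" and A = Act]) (simp_all add: pol_simplex)

lemma sum_minus_weight:
  "t \<le> T \<Longrightarrow> h \<in> {1..H} \<Longrightarrow> (\<Sum>b\<in>PiE ({..<N} - {i}) Act. \<Prod>k\<in>{..<N} - {i}. pol t h k s (b k)) = 1"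
  by (rule sum_PiE_prod_simplex[where p = "\<lambda>k. pol t h k s"]) (simp_all add: pol_simplex)

lemma util0: "util 0 h i s b = 0"
  by (simp add: util_def prodQ_minus_def Q0)

lemma util_bounds:
  assumes "t \<le> T" "h \<in> {1..H}" "i < N" "x \<in> Act i"
  shows "0 \<le> util t h i s x" "util t h i s x \<le> real H"
proof -
  let ?w = "\<lambda>b. \<Prod>k\<in>{..<N} - {i}. pol t h k s (b k)"
  have "util t h i s x \<le> (\<Sum>b\<in>PiE ({..<N} - {i}) Act. real H * ?w b)"
    unfolding util_def prodQ_minus_def
    using assms by (intro sum_mono mult_right_mono Q_bounds upd_joint minus_weight_nonneg) auto
  also have "\<dots> = real H" using sum_minus_weight[OF assms(1,2)] by (simp flip: sum_distrib_left)
  finally show "util t h i s x \<le> real H" .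
  show "0 \<le> util t h i s x"
    unfolding util_def prodQ_minus_def
    using assms by (intro sum_nonneg mult_nonneg_nonneg Q_bounds upd_joint minus_weight_nonneg) auto
qed

text \<open>The value estimate and the product measure are changed separately. The agent's own
  action is an argument of its utility and is not averaged over, so its own drift is absent.\<close>

lemma util_diff:
  assumes "t \<in> {1..T}" "h \<in> {1..H}" "i < N" "x \<in> Act i"
  shows "\<bar>util t h i s x - util (t - 1) h i s x\<bar>
    \<le> alpha H t * real H + real H * (\<Sum>k\<in>{..<N} - {i}. drift t h k s)"
proof -
  let ?I = "{..<N} - {i}"
  let ?B = "PiE ?I Act"
  define w where "w b = (\<Prod>k\<in>?I. pol t h k s (b k))" for b
  define w' where "w' b = (\<Prod>k\<in>?I. pol (t - 1) h k s (b k))" for b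
  define q where "q b = Q t h i s (b(i := x))" for b
  define q' where "q' b = Q (t - 1) h i s (b(i := x))" for b
  have t: "t \<le> T" "t - 1 \<le> T" using assms by auto
  have up: "b(i := x) \<in> joint N Act" if "b \<in> ?B" for b using upd_joint that assms by blast
  have "util t h i s x - util (t - 1) h i s x = (\<Sum>b\<in>?B. (q b - q' b) * w b + q' b * (w b - w' b))"
    unfolding util_def prodQ_minus_def w_def w'_def q_def q'_def
    by (simp add: algebra_simps flip: sum_subtractf)
  also have "\<bar>\<dots>\<bar> \<le> (\<Sum>b\<in>?B. (alpha H t * real H) * w b + real H * \<bar>w b - w' b\<bar>)"
  proof (rule order_trans[OF sum_abs], rule sum_mono)
    fix b assume b: "b \<in> ?B"
    have "\<bar>(q b - q' b) * w b\<bar> \<le> (alpha H t * real H) * w b"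
      using Q_diff[OF assms(1-3) up[OF b], of s] minus_weight_nonneg[OF t(1) assms(2) b, of s]
      unfolding abs_mult q_def q'_def w_def by (simp add: mult_right_mono)
    moreover have "\<bar>q' b * (w b - w' b)\<bar> \<le> real H * \<bar>w b - w' b\<bar>"
      using Q_bounds[OF t(2) assms(2,3) up[OF b], of s]
      unfolding abs_mult q'_def by (intro mult_right_mono) auto
    ultimately show "\<bar>(q b - q' b) * w b + q' b * (w b - w' b)\<bar>
        \<le> (alpha H t * real H) * w b + real H * \<bar>w b - w' b\<bar>" by linarith
  qed
  also have "\<dots> = alpha H t * real H * (\<Sum>b\<in>?B. w b) + real H * (\<Sum>b\<in>?B. \<bar>w b - w' b\<bar>)"
    by (simp only: sum.distrib sum_distrib_left)
  also have "(\<Sum>b\<in>?B. w b) = 1" unfolding w_def by (rule sum_minus_weight[OF t(1) assms(2)])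
  also have "(\<Sum>b\<in>?B. \<bar>w b - w' b\<bar>) \<le> (\<Sum>k\<in>?I. drift t h k s)"
    unfolding w_def w'_def drift_def
    using t assms(2)
    by (intro sum_PiE_prod_diff[where p = "\<lambda>k. pol t h k s" and q = "\<lambda>k. pol (t - 1) h k s"])
       (simp_all add: pol_simplex)
  finally show ?thesis by (simp add: mult_left_mono)
qed

section \<open>Values of the output policy and the cost of deviating from it\<close>

lemma sum_joint_split:
  assumes "i < N"
  shows "(\<Sum>a\<in>joint N Act. (\<Prod>k<N. p k s (a k)) * F s (a(i := g (a i))))
    = (\<Sum>x\<in>Act i. p i s x * prodQ_minus N Act F p i s (g x))"
proof -
  let ?I = "{..<N} - {i}"
  have ins: "{..<N} = insert i ?I" using assms by auto
  have w: "(\<Prod>k<N. p k s ((b(i := x)) k)) = p i s x * (\<Prod>k\<in>?I. p k s (b k))" for b x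
  proof -
    have "(\<Prod>k<N. p k s ((b(i := x)) k)) = p i s x * (\<Prod>k\<in>?I. p k s ((b(i := x)) k))"
      using assms by (subst prod.remove[of _ i]) auto
    also have "(\<Prod>k\<in>?I. p k s ((b(i := x)) k)) = (\<Prod>k\<in>?I. p k s (b k))"
      by (intro prod.cong) auto
    finally show ?thesis .
  qed
  have "joint N Act = PiE (insert i ?I) Act" unfolding joint_def ins[symmetric] ..
  then have "(\<Sum>a\<in>joint N Act. (\<Prod>k<N. p k s (a k)) * F s (a(i := g (a i))))
    = (\<Sum>x\<in>Act i. \<Sum>b\<in>PiE ?I Act. (\<Prod>k<N. p k s ((b(i := x)) k)) * F s (b(i := g x)))"
    by (simp only: sum_PiE_insert[of i ?I] Diff_iff singletonI not_True_eq_False simp_thms fun_upd_upd fun_upd_same not_False_eq_True)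
  also have "\<dots> = (\<Sum>x\<in>Act i. p i s x * prodQ_minus N Act F p i s (g x))"
    unfolding w by (simp add: prodQ_minus_def sum_distrib_left mult_ac)
  finally show ?thesis .
qed

lemma Q_unfold:
  assumes "h \<in> {1..H}" "i < N" "a \<in> joint N Act" "t \<ge> 1" "t \<le> T"
  shows "Q t h i s a = (\<Sum>j\<in>{1..t}. alpha_w H t j * target j h i s a)"
  using assms(4,5)
proof (induction t rule: nat_induct_at_least)
  case base
  then show ?case using Q_step[of 1 h i a s] assms by (simp add: alpha_w_self alpha_one[simplified])
next
  case (Suc t)
  then show ?case using Q_step[of "Suc t" h i a s] assms by (simp only: sum_alpha_w_Suc) simp
qed

text \<open>The stage values mixed over the shared index that the output policy samples;
  \<open>Vout_id\<close> identifies this with the true value of that policy.\<close>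

definition val :: "nat \<Rightarrow> nat \<Rightarrow> nat \<Rightarrow> 's \<Rightarrow> real" where
  "val t h i s = (\<Sum>j\<in>{1..t}. alpha_w H t j * prodQ N Act (Q j h i) (pol j h) s)"

text \<open>The weights \<open>alpha_w\<close> sum to 1 and averaging with them commutes with the
  expectation over \<open>s'\<close>, so the estimate is an exact Bellman backup of
  \<open>val\<close>. This is why the output policy resamples its index at every step.\<close>

lemma Q_val:
  assumes "h \<in> {1..H}" "i < N" "a \<in> joint N Act" "t \<ge> 1" "t \<le> T"
  shows "Q t h i s a = r h i s a + (\<Sum>s'\<in>UNIV. P h s a s' * val t (h + 1) i s')"
proof -
  have "Q t h i s a = r h i s a * (\<Sum>j\<in>{1..t}. alpha_w H t j)
     + (\<Sum>j\<in>{1..t}. \<Sum>s'\<in>UNIV. P h s a s' * (alpha_w H t j * prodQ N Act (Q j (h + 1) i) (pol j (h + 1)) s'))"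
    unfolding Q_unfold[OF assms] target_def
    by (simp add: distrib_left sum.distrib sum_distrib_left mult_ac)
  also have "\<dots> = r h i s a + (\<Sum>s'\<in>UNIV. P h s a s' * val t (h + 1) i s')"
    using sum_alpha_w[OF assms(4)] unfolding val_def by (subst sum.swap) (simp add: sum_distrib_left)
  finally show ?thesis .
qed

lemma Vout_id:
  assumes "i < N" "m \<le> H" "t \<ge> 1" "t \<le> T"
  shows "Vout N H Act r P pol i (\<lambda>h s a. a) m t s = val t (H + 1 - m) i s"
  using assms(2-)
proof (induction m arbitrary: t s)
  case 0
  then show ?case using Q_last by (simp add: val_def prodQ_def)
next
  case (Suc m)
  have h: "H - m \<in> {1..H}" "H - m + 1 = H + 1 - m" "H + 1 - Suc m = H - m" using Suc.prems by auto
  have "r (H - m) i s a + (\<Sum>s'\<in>UNIV. P (H - m) s a s' * Vout N H Act r P pol i (\<lambda>h s a. a) m j s')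
      = Q j (H - m) i s a" if "j \<in> {1..t}" "a \<in> joint N Act" for j a
    using that Suc h by (subst Q_val[OF h(1) assms(1)]) auto
  then show ?case unfolding h(3) by (simp add: val_def prodQ_def Let_def mult.commute)
qed

definition swap_regret :: "nat \<Rightarrow> nat \<Rightarrow> nat \<Rightarrow> 's \<Rightarrow> ('a \<Rightarrow> 'a) \<Rightarrow> real" where
  "swap_regret t h i s f =
     (\<Sum>j\<in>{1..t}. alpha_w H t j * (\<Sum>x\<in>Act i. pol j h i s x * (util j h i s (f x) - util j h i s x)))"

text \<open>By induction later deviations gain at most \<open>G * C / real j\<close> in every state,
  a constant shift of the next value. What remains at the current step is a one-step modification by
  \<open>\<phi> h s\<close>, whose gain is a swap regret. Averaging \<open>1 / real j\<close>
  multiplies \<open>G\<close> by 1 + 1/H, hence the geometric sum.\<close>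

lemma Vout_gap:
  assumes i: "i < N" and \<phi>: "\<phi> \<in> strat_mods Act i" and C: "0 \<le> C"
    and reg: "\<And>t h s f. t \<in> {1..T} \<Longrightarrow> h \<in> {1..H} \<Longrightarrow> f \<in> Act i \<rightarrow> Act i \<Longrightarrow> swap_regret t h i s f \<le> C / real t"
    and "m \<le> H" "t \<ge> 1" "t \<le> T"
  shows "Vout N H Act r P pol i \<phi> m t s - Vout N H Act r P pol i (\<lambda>h s a. a) m t s
    \<le> (\<Sum>k<m. (1 + 1 / real H) ^ k) * C / real t"
  using assms(5-)
proof (induction m arbitrary: t s)
  case 0
  then show ?case by simp
next
  case (Suc m)
  define G where "G = (\<Sum>k<m. (1 + 1 / real H) ^ k)"
  have G0: "0 \<le> G" unfolding G_def by (intro sum_nonneg) simp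
  define h where "h = H - m"
  have h: "h \<in> {1..H}" "h + 1 = H + 1 - m" "H + 1 - Suc m = h" "H - m = h"
    using Suc.prems by (auto simp: h_def)
  define f where "f = \<phi> h s"
  have f: "f \<in> Act i \<rightarrow> Act i" using \<phi> by (auto simp: f_def strat_mods_def)
  define F where "F j a = r h i s a + (\<Sum>s'\<in>UNIV. P h s a s' * Vout N H Act r P pol i \<phi> m j s')" for j a
  define w where "w j a = (\<Prod>k<N. pol j h k s (a k))" for j a
  have FQ: "F j a \<le> Q j h i s a + G * C / real j" if j: "j \<in> {1..t}" and a: "a \<in> joint N Act" for j a
  proof -
    have j': "1 \<le> j" "j \<le> T" using j Suc.prems by auto
    have "Vout N H Act r P pol i \<phi> m j s' \<le> val j (h + 1) i s' + G * C / real j" for s'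
      using Suc.IH[of j s'] Vout_id[of i m j s'] j' Suc.prems i h(2) by (simp add: G_def)
    then have "(\<Sum>s'\<in>UNIV. P h s a s' * Vout N H Act r P pol i \<phi> m j s')
       \<le> (\<Sum>s'\<in>UNIV. P h s a s' * (val j (h + 1) i s' + G * C / real j))"
      using P(1)[OF h(1) a] by (intro sum_mono mult_left_mono) auto
    also have "\<dots> = (\<Sum>s'\<in>UNIV. P h s a s' * val j (h + 1) i s') + G * C / real j"
      using P(2)[OF h(1) a, of s] by (simp only: distrib_left sum.distrib mult_1 flip: sum_distrib_right)
    finally show ?thesis unfolding F_def Q_val[OF h(1) i a j'] by simp
  qed
  have upd: "a(i := f (a i)) \<in> joint N Act" if "a \<in> joint N Act" for a
  proof -
    have "a i \<in> Act i" using that i by (auto simp: joint_def)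
    then have "f (a i) \<in> Act i" using f by auto
    from PiE_fun_upd[OF this that[unfolded joint_def]] show ?thesis
      using i by (simp add: joint_def insert_absorb)
  qed
  have w0: "0 \<le> w j a" if "j \<in> {1..t}" "a \<in> joint N Act" for j a
    unfolding w_def using that Suc.prems h by (intro joint_weight_nonneg) auto
  have ws: "(\<Sum>a\<in>joint N Act. w j a) = 1" if "j \<in> {1..t}" for j
    unfolding w_def using that Suc.prems h by (intro sum_joint_weight) auto
  have aw: "0 \<le> alpha_w H t j" if "j \<in> {1..t}" for j
    using alpha_w_pos[of j t H] that by simp
  have Vid: "Vout N H Act r P pol i (\<lambda>h s a. a) (Suc m) t s
      = (\<Sum>j\<in>{1..t}. alpha_w H t j * (\<Sum>x\<in>Act i. pol j h i s x * util j h i s x))"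
  proof -
    have "prodQ N Act (Q j h i) (pol j h) s = (\<Sum>x\<in>Act i. pol j h i s x * util j h i s x)" for j
      using sum_joint_split[OF i, of "pol j h" s "Q j h i" "\<lambda>x. x"]
      by (simp add: prodQ_def util_def mult.commute)
    then show ?thesis using Vout_id[of i "Suc m" t s] i Suc.prems h by (simp add: val_def)
  qed
  have "Vout N H Act r P pol i \<phi> (Suc m) t s
      = (\<Sum>j\<in>{1..t}. alpha_w H t j * (\<Sum>a\<in>joint N Act. w j a * F j (a(i := f (a i)))))"
    by (simp add: Let_def h(4) f_def F_def w_def)
  also have "\<dots> \<le> (\<Sum>j\<in>{1..t}. alpha_w H t j * ((\<Sum>x\<in>Act i. pol j h i s x * util j h i s (f x)) + G * C / real j))"
  proof (intro sum_mono mult_left_mono aw)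
    fix j assume j: "j \<in> {1..t}"
    have "(\<Sum>a\<in>joint N Act. w j a * F j (a(i := f (a i))))
       \<le> (\<Sum>a\<in>joint N Act. w j a * (Q j h i s (a(i := f (a i))) + G * C / real j))"
      using j w0 FQ upd by (intro sum_mono mult_left_mono) auto
    also have "\<dots> = (\<Sum>a\<in>joint N Act. w j a * Q j h i s (a(i := f (a i)))) + G * C / real j"
      using ws[OF j] by (simp only: distrib_left sum.distrib mult_1 flip: sum_distrib_right)
    also have "(\<Sum>a\<in>joint N Act. w j a * Q j h i s (a(i := f (a i))))
       = (\<Sum>x\<in>Act i. pol j h i s x * util j h i s (f x))"
      unfolding w_def util_def by (rule sum_joint_split[OF i])
    finally show "(\<Sum>a\<in>joint N Act. w j a * F j (a(i := f (a i))))
      \<le> (\<Sum>x\<in>Act i. pol j h i s x * util j h i s (f x)) + G * C / real j" .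
  qed
  also have "\<dots> = (\<Sum>j\<in>{1..t}. alpha_w H t j * (\<Sum>x\<in>Act i. pol j h i s x * util j h i s (f x)))
      + G * C * (\<Sum>j\<in>{1..t}. alpha_w H t j * (1 / real j))"
    by (simp add: distrib_left sum.distrib sum_distrib_left mult_ac)
  also have "\<dots> - Vout N H Act r P pol i (\<lambda>h s a. a) (Suc m) t s
      = swap_regret t h i s f + G * C * (\<Sum>j\<in>{1..t}. alpha_w H t j * (1 / real j))"
    unfolding Vid swap_regret_def by (simp add: right_diff_distrib sum_subtractf)
  also have "\<dots> \<le> C / real t + G * C * ((1 + 1 / real H) / real t)"
    using reg[OF _ h(1) f, of t s] Suc.prems sum_alpha_w_inverse[OF H_ge_one, of t] G0 C
    by (intro add_mono mult_left_mono) auto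
  also have "\<dots> = (1 + (1 + 1 / real H) * G) * C / real t"
    by (simp add: algebra_simps add_divide_distrib)
  also have "1 + (1 + 1 / real H) * G = (\<Sum>k<Suc m. (1 + 1 / real H) ^ k)"
    unfolding G_def sum.lessThan_Suc_shift by (simp add: sum_distrib_left)
  finally show ?case by simp
qed

end

section \<open>Stability of the policies\<close>

text \<open>Relative to the current weight, the past weighs only (t - 1) / (H + 1); in
  \<open>grad_diff\<close> this cancels the range \<open>H\<close> of the utilities.\<close>

lemma sum_wgt:
  assumes "t \<ge> 1"
  shows "(\<Sum>j\<in>{1..<t}. wgt H j j) = wgt H t t * (real t - 1) / (real H + 1)"
  using assms
proof (induction t rule: nat_induct_at_least)
  case (Suc t)
  have "(\<Sum>j\<in>{1..<Suc t}. wgt H j j) = wgt H t t * (real t - 1) / (real H + 1) + wgt H t t"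
    using Suc by simp
  also have "\<dots> = wgt H t t * (real H + real t) / (real H + 1)" by (simp add: field_simps)
  also have "\<dots> = wgt H (Suc t) (Suc t) * (real (Suc t) - 1) / (real H + 1)"
    using Suc.hyps by (simp add: wgt_diag_Suc)
  finally show ?case .
qed simp

section \<open>Consequences of the prescribed learning rate\<close>

locale bm_oftrl_tuned = bm_oftrl +
  assumes N_ge_one: "N \<ge> 1" and T_ge_two: "T \<ge> 2"
    and eta: "\<eta> = 1 / (256 * real N * real H * sqrt (real H * real (A_max N Act)))"
begin

abbreviation "A \<equiv> real (A_max N Act)"

lemma card_le: "i < N \<Longrightarrow> real (card (Act i)) \<le> A"
  unfolding A_max_def by (intro of_nat_mono Max_ge) auto

lemma card_ge: "i < N \<Longrightarrow> 1 \<le> real (card (Act i))"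
  using Act[of i] by (simp add: Suc_le_eq card_gt_0_iff)

lemma A_ge_one: "1 \<le> A"
  using card_ge[of 0] card_le[of 0] N_ge_one by simp

lemma eta_pos: "0 < \<eta>"
  using N_ge_one H_ge_one A_ge_one by (simp add: eta)

text \<open>The product that multiplies the drift when it is fed back into itself in
  \<open>weighted_regret_bound\<close>; 65536 is 256 squared.\<close>

lemma eta_sq: "\<eta>\<^sup>2 * (real N)\<^sup>2 * real H ^ 3 * A = 1 / 65536"
proof -
  have "(sqrt (real H * A))\<^sup>2 = real H * A" using A_ge_one by simp
  then show ?thesis using N_ge_one H_ge_one A_ge_one
    by (simp add: eta power_divide power_mult_distrib field_simps power2_eq_square power3_eq_cube)
qed

lemma eta_inv_ge: "256 * real H \<le> 1 / \<eta>"
proof -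
  have "1 \<le> real H * A" using H_ge_one A_ge_one mult_mono[of 1 "real H" 1 A] by simp
  then have "1 \<le> sqrt (real H * A)" by simp
  then have "1 * 1 \<le> real N * sqrt (real H * A)" using N_ge_one by (intro mult_mono) auto
  then have "256 * real H * 1 \<le> 256 * real H * (real N * sqrt (real H * A))"
    by (intro mult_left_mono) auto
  then show ?thesis by (simp add: eta mult_ac)
qed

lemma eta_H: "\<eta> * real H \<le> 1 / 256"
  using eta_inv_ge eta_pos by (simp add: field_simps)

end

section \<open>Learning dynamics at one fixed step and state\<close>

locale bm_oftrl_state = bm_oftrl_tuned N H T Act r P pol Q \<eta>
  for N H T and Act :: "nat \<Rightarrow> 'a set" and r :: "nat \<Rightarrow> nat \<Rightarrow> 's::finite \<Rightarrow> (nat \<Rightarrow> 'a) \<Rightarrow> real"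
    and P pol Q \<eta> +
  fixes h :: nat and s :: 's
  assumes h: "h \<in> {1..H}"
begin

abbreviation "W j \<equiv> wgt H j j"
abbreviation "p j i \<equiv> pol j h i s"
abbreviation "u j i \<equiv> util j h i s"
abbreviation "\<delta> j i \<equiv> drift j h i s"

text \<open>The utility fed to the learner of row \<open>a\<close>. Scaling by the probability that
  \<open>a\<close> is played makes the external regrets of the rows add up to the swap
  regret.\<close>

definition v :: "nat \<Rightarrow> 'a \<Rightarrow> nat \<Rightarrow> 'a \<Rightarrow> real" where
  "v i a j b = p j i a * u j i b"

definition grad :: "nat \<Rightarrow> nat \<Rightarrow> 'a \<Rightarrow> 'a \<Rightarrow> real" where
  "grad t i a b = \<eta> * ((\<Sum>j\<in>{1..<t}. W j * v i a j b) + W t * v i a (t - 1) b) / W t"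

definition is_update :: "nat \<Rightarrow> nat \<Rightarrow> ('a \<Rightarrow> 'a \<Rightarrow> real) \<Rightarrow> bool" where
  "is_update t i q \<longleftrightarrow> (\<forall>a\<in>Act i. is_lb_argmax (Act i) (grad t i a) (q a)) \<and>
     (\<forall>b\<in>Act i. p t i b = (\<Sum>a\<in>Act i. p t i a * q a b))"

text \<open>The run asserts the matrix only existentially in each round; the choice turns these
  matrices into a sequence that can be compared across rounds.\<close>

definition row :: "nat \<Rightarrow> nat \<Rightarrow> 'a \<Rightarrow> 'a \<Rightarrow> real" where
  "row t i = (SOME q. is_update t i q)"

lemma grad_loss:
  assumes "t \<ge> 1"
  shows "\<eta> * loss N H Act pol Q t h i s a b / wgt H t t = grad t i a b"
proof -
  have "(\<Sum>j\<in>{1..<t}. wgt H t j * pol j h i s a * prodQ_minus N Act (Q j h i) (pol j h) i s b)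
      = (\<Sum>j\<in>{1..<t}. W j * v i a j b)"
    by (intro sum.cong) (auto simp: v_def util_def wgt_eq_diag[of _ t])
  then show ?thesis unfolding loss_def grad_def by (simp add: v_def util_def mult.assoc)
qed

lemma row_update:
  assumes "1 \<le> t" "t \<le> T" "i < N"
  shows "is_update t i (row t i)"
proof -
  have "\<forall>t\<in>{1..T}. \<forall>h\<in>{1..H}. \<forall>i<N. \<forall>s.
        pol t h i s \<in> prob_simplex (Act i) \<and>
        (\<exists>q. (\<forall>ai\<in>Act i.
                 is_lb_argmax (Act i) (\<lambda>ai'. \<eta> * loss N H Act pol Q t h i s ai ai' / wgt H t t) (q ai)) \<and>
             (\<forall>ai'\<in>Act i. pol t h i s ai' = (\<Sum>ai\<in>Act i. pol t h i s ai * q ai ai')))"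
    using run unfolding bm_oftrl_run_def by (elim conjE)
  from this[rule_format, of t h i s] assms h have "\<exists>q. is_update t i q"
    unfolding is_update_def grad_loss[OF assms(1)] by auto
  then show ?thesis unfolding row_def by (rule someI_ex)
qed

lemma row_argmax:
  "1 \<le> t \<Longrightarrow> t \<le> T \<Longrightarrow> i < N \<Longrightarrow> a \<in> Act i \<Longrightarrow> is_lb_argmax (Act i) (grad t i a) (row t i a)"
  using row_update[of t i] by (simp add: is_update_def)

lemma row_fixed:
  "1 \<le> t \<Longrightarrow> t \<le> T \<Longrightarrow> i < N \<Longrightarrow> b \<in> Act i \<Longrightarrow> p t i b = (\<Sum>a\<in>Act i. p t i a * row t i a b)"
  using row_update[of t i] by (simp add: is_update_def)

lemma row_simplex:
  "1 \<le> t \<Longrightarrow> t \<le> T \<Longrightarrow> i < N \<Longrightarrow> a \<in> Act i \<Longrightarrow> row t i a \<in> prob_simplex (Act i)"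
  using row_argmax[of t i a] by (simp add: is_lb_argmax_def)

lemma row_pos:
  "1 \<le> t \<Longrightarrow> t \<le> T \<Longrightarrow> i < N \<Longrightarrow> a \<in> Act i \<Longrightarrow> b \<in> Act i \<Longrightarrow> 0 < row t i a b"
  using row_argmax[of t i a] by (simp add: is_lb_argmax_def)

lemma v_bounds:
  assumes "t \<le> T" "i < N" "a \<in> Act i" "b \<in> Act i"
  shows "0 \<le> v i a t b" "v i a t b \<le> real H * p t i a" "v i a t b \<le> real H"
proof -
  have p: "0 \<le> p t i a" "p t i a \<le> 1"
    using pol_nonneg[OF assms(1) h assms(2,3), of s] sum_pol[OF assms(1) h assms(2), of s]
      member_le_sum[of a "Act i" "p t i"] pol_nonneg[OF assms(1) h assms(2), of _ s] Act(1)[OF assms(2)] assms(3)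
    by auto
  have u: "0 \<le> u t i b" "u t i b \<le> real H" using util_bounds[OF assms(1) h assms(2,4)] by auto
  show "0 \<le> v i a t b" using p u by (simp add: v_def)
  show le: "v i a t b \<le> real H * p t i a" using mult_left_mono[OF u(2) p(1)] by (simp add: v_def mult.commute)
  have "real H * p t i a \<le> real H * 1" using p by (intro mult_left_mono) auto
  then show "v i a t b \<le> real H" using le by simp
qed

lemma v0: "v i a 0 b = 0"
  by (simp add: v_def util0)

lemma W_pos: "1 \<le> j \<Longrightarrow> 0 < W j"
  by (rule wgt_pos) auto

lemma W_Suc: "1 \<le> j \<Longrightarrow> W (Suc j) = W j * ((real H + real j) / real j)"
  by (rule wgt_diag_Suc)

lemma W_mono: "1 \<le> j \<Longrightarrow> W j \<le> W (Suc j)"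
  using W_pos[of j] by (simp add: W_Suc field_simps)

text \<open>The growth factor (H + j) / j is largest at \<open>j = 1\<close>, where it is H + 1.
  This bound is the price of the index shift in \<open>sum_drift_le\<close>.\<close>

lemma W_Suc_le: "1 \<le> j \<Longrightarrow> W (Suc j) \<le> 2 * real H * W j"
proof -
  assume j: "1 \<le> j"
  have "real H * 1 \<le> real H * real j" using j by (intro mult_left_mono) auto
  moreover have "1 * real j \<le> real H * real j" using H_ge_one by (intro mult_right_mono) auto
  ultimately have "real H + real j \<le> 2 * real H * real j" by linarith
  then have "(real H + real j) / real j \<le> 2 * real H" using j by (simp add: divide_le_eq)
  then have "W j * ((real H + real j) / real j) \<le> W j * (2 * real H)"
    using W_pos[OF j] by (intro mult_left_mono) auto
  then show ?thesis using W_Suc[OF j] by (simp add: mult_ac)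
qed

text \<open>Because the gradient is divided by the current weight, a new round rescales the past by
  \<open>c\<close>, the ratio of consecutive weights. The normalised past \<open>X\<close> is at
  most \<open>t\<close>, and (1 - c) t = H c, so the rescaling costs at most \<open>H\<close>
  although the past is long. Every other term is a single utility.\<close>

lemma grad_diff:
  assumes t: "1 \<le> t" "t < T" and i: "i < N" and a: "a \<in> Act i" and b: "b \<in> Act i"
  shows "\<bar>grad (Suc t) i a b - grad t i a b\<bar> \<le> 3 * (\<eta> * real H)"
proof -
  define S where "S = (\<Sum>j\<in>{1..<t}. W j * v i a j b)"
  define X where "X = S / W t"
  define c where "c = real t / (real H + real t)"
  have Wt: "0 < W t" and c: "0 \<le> c" "c \<le> 1" using W_pos t by (auto simp: c_def)
  have WS: "W (Suc t) = W t / c" using W_Suc[OF t(1)] t by (simp add: c_def)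
  have c0: "c \<noteq> 0" using t by (auto simp: c_def)
  have v: "0 \<le> v i a j b" "v i a j b \<le> real H" if "j < T" for j
    using v_bounds[of j i a b] that i a b by auto
  have S0: "0 \<le> S" unfolding S_def using v t W_pos
    by (intro sum_nonneg mult_nonneg_nonneg) (auto simp: less_imp_le)
  have "S \<le> (\<Sum>j\<in>{1..<t}. W j * real H)" unfolding S_def using v t W_pos
    by (intro sum_mono mult_left_mono) (auto simp: less_imp_le)
  also have "\<dots> = real H * (W t * (real t - 1) / (real H + 1))"
    using sum_wgt[OF t(1), of H] by (simp add: mult.commute flip: sum_distrib_left)
  finally have "X \<le> real H * (real t - 1) / (real H + 1)" using Wt by (simp add: X_def field_simps)
  also have "\<dots> \<le> real t - 1"
    using t H_ge_one by (simp add: field_simps)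
  finally have X: "0 \<le> X" "X \<le> real t" using S0 Wt by (auto simp: X_def)
  have "(1 - c) * X \<le> (1 - c) * real t" using X c by (intro mult_left_mono) auto
  also have "\<dots> = real H * c" using t by (simp add: c_def field_simps)
  also have "\<dots> \<le> real H" using c by (simp add: mult_left_le)
  finally have X1: "0 \<le> (1 - c) * X" "(1 - c) * X \<le> real H" using X c by auto
  have "c * v i a t b \<le> 1 * v i a t b" using v[of t] c t by (intro mult_right_mono) auto
  then have cv: "0 \<le> c * v i a t b" "c * v i a t b \<le> real H" using v[of t] t c by auto
  have gS: "grad (Suc t) i a b = \<eta> * (c * X + c * v i a t b + v i a t b)"
    unfolding grad_def using t Wt c0 unfolding WS
    by (simp add: S_def[simplified] X_def field_simps)
  have g: "grad t i a b = \<eta> * (X + v i a (t - 1) b)"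
    unfolding grad_def S_def[symmetric] using Wt by (simp add: X_def field_simps)
  have "grad (Suc t) i a b - grad t i a b
      = \<eta> * (c * v i a t b + v i a t b - (1 - c) * X - v i a (t - 1) b)"
    unfolding gS g by (simp add: algebra_simps)
  moreover have "\<bar>c * v i a t b + v i a t b - (1 - c) * X - v i a (t - 1) b\<bar> \<le> 3 * real H"
    using v[of t] v[of "t - 1"] t X1 cv by linarith
  ultimately show ?thesis using eta_pos by (simp add: abs_mult mult_left_mono)
qed

section \<open>From relative row changes to the drift of the policy\<close>

definition rel :: "nat \<Rightarrow> nat \<Rightarrow> 'a \<Rightarrow> 'a \<Rightarrow> real" where
  "rel j i a b = row (Suc j) i a b / row j i a b - 1"

definition chg :: "nat \<Rightarrow> nat \<Rightarrow> real" where
  "chg j i = (\<Sum>a\<in>Act i. \<Sum>b\<in>Act i. (rel j i a b)\<^sup>2)"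

text \<open>The factor \<open>row (Suc j) i a b\<close> is kept so that the squares still sum to at
  most 1/4 over \<open>b\<close>, however many actions there are.\<close>

lemma rel_bound:
  assumes "1 \<le> j" "j < T" "i < N" "a \<in> Act i" "b \<in> Act i"
  shows "\<bar>rel j i a b\<bar> \<le> 1 / 2 * row (Suc j) i a b"
proof -
  have "\<bar>rel j i a b\<bar> \<le> 2 * (3 * (\<eta> * real H)) * row (Suc j) i a b"
    unfolding rel_def
    by (rule log_barrier_stable[OF Act(1) row_argmax[of j i a] row_argmax[of "Suc j" i a] grad_diff])
      (use assms in auto)
  also have "\<dots> \<le> 1 / 2 * row (Suc j) i a b"
    using eta_H row_pos[of "Suc j" i a b] assms by (intro mult_right_mono) auto
  finally show ?thesis .
qed

text \<open>The Euclidean norm \<open>e a\<close> of the relative changes of row \<open>a\<close>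
  dominates each of them, stays below 1/2 by \<open>rel_bound\<close>, and has a square that adds up
  to \<open>chg\<close>. The perturbation bound contributes 4 squared, and Cauchy-Schwarz over the
  rows contributes \<open>A\<close>.\<close>

lemma drift_chg:
  assumes j: "1 \<le> j" "j < T" and i: "i < N"
  shows "(\<delta> (Suc j) i)\<^sup>2 \<le> 16 * A * chg j i"
proof -
  have j': "j \<le> T" "1 \<le> Suc j" "Suc j \<le> T" using j by auto
  define e where "e a = sqrt (\<Sum>b\<in>Act i. (rel j i a b)\<^sup>2)" for a
  have fin: "finite (Act i)" using Act i by blast
  have pos: "pos_stochastic (Act i) (row t i)" if "1 \<le> t" "t \<le> T" for t
    using row_simplex[OF that i] row_pos[OF that i] by (simp add: pos_stochastic_def prob_simplex_def)
  have st: "stationary (Act i) (row t i) (p t i)" if "1 \<le> t" "t \<le> T" for t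
    using row_fixed[OF that i] pol_simplex[OF that(2) h i] unfolding stationary_def by blast
  have 1: "\<bar>row (Suc j) i a b - row j i a b\<bar> \<le> e a * row j i a b" if "a \<in> Act i" "b \<in> Act i" for a b
  proof -
    have "(rel j i a b)\<^sup>2 \<le> (\<Sum>b\<in>Act i. (rel j i a b)\<^sup>2)"
      using that fin by (intro member_le_sum) auto
    then have "\<bar>rel j i a b\<bar> \<le> e a" unfolding e_def
      by (metis real_sqrt_abs real_sqrt_le_mono)
    moreover have "row (Suc j) i a b - row j i a b = rel j i a b * row j i a b"
      using row_pos[OF j(1) j'(1) i that] by (simp add: rel_def algebra_simps)
    ultimately show ?thesis using row_pos[OF j(1) j'(1) i that]
      by (simp add: abs_mult mult_right_mono)
  qed
  have 2: "e a \<le> 1 / 2" if a: "a \<in> Act i" for a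
  proof -
    have rs: "(\<Sum>b\<in>Act i. row (Suc j) i a b) = 1"
      using row_simplex[OF j'(2,3) i a] by (simp add: prob_simplex_def)
    have "(\<Sum>b\<in>Act i. (rel j i a b)\<^sup>2) \<le> (\<Sum>b\<in>Act i. 1 / 4 * row (Suc j) i a b)"
    proof (rule sum_mono)
      fix b assume b: "b \<in> Act i"
      have rp: "0 < row (Suc j) i a b" "row (Suc j) i a b \<le> 1"
        using row_pos[OF j'(2,3) i a] b rs member_le_sum[of b "Act i" "row (Suc j) i a"] fin
        by (auto simp: less_imp_le)
      have "(rel j i a b)\<^sup>2 \<le> (1 / 2 * row (Suc j) i a b)\<^sup>2"
        using rel_bound[OF j i a b] rp by (simp add: abs_le_square_iff[symmetric])
      also have "\<dots> = 1 / 4 * (row (Suc j) i a b * row (Suc j) i a b)" by (simp add: power2_eq_square)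
      also have "\<dots> \<le> 1 / 4 * (row (Suc j) i a b * 1)" using rp by (intro mult_left_mono) auto
      finally show "(rel j i a b)\<^sup>2 \<le> 1 / 4 * row (Suc j) i a b" by simp
    qed
    also have "\<dots> = (1 / 2)\<^sup>2" using rs by (simp add: power2_eq_square flip: sum_divide_distrib)
    finally show ?thesis unfolding e_def by (rule real_le_lsqrt[rotated -1]) auto
  qed
  have d: "\<delta> (Suc j) i \<le> 4 * (\<Sum>a\<in>Act i. e a)"
    using stationary_perturb[OF fin pos[OF j(1) j'(1)] pos[OF j'(2,3)] st[OF j(1) j'(1)] st[OF j'(2,3)] 1 2]
    unfolding drift_def by simp
  have d0: "0 \<le> \<delta> (Suc j) i" unfolding drift_def by (intro sum_nonneg) auto
  have "(\<delta> (Suc j) i)\<^sup>2 \<le> (4 * (\<Sum>a\<in>Act i. e a))\<^sup>2" using d d0 by (rule power_mono)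
  also have "\<dots> = 16 * (\<Sum>a\<in>Act i. e a)\<^sup>2" by (simp add: power_mult_distrib)
  also have "(\<Sum>a\<in>Act i. e a)\<^sup>2 \<le> (\<Sum>a\<in>Act i. (e a)\<^sup>2) * card (Act i)"
    by (rule sum_squared_le_sum_of_squares)
  also have "(\<Sum>a\<in>Act i. (e a)\<^sup>2) = chg j i"
    unfolding e_def chg_def by (intro sum.cong) (auto intro!: sum_nonneg)
  also have "chg j i * card (Act i) \<le> chg j i * A"
    using card_le[OF i] by (intro mult_left_mono) (auto simp: chg_def intro!: sum_nonneg)
  finally show ?thesis by (simp add: mult_ac)
qed

text \<open>In the first round the gradients vanish, so every row maximises the barrier alone and is
  uniform; its stationary distribution is the uniform initial policy. This covers the one drift that
  no earlier row change can pay for.\<close>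

lemma drift_one:
  assumes i: "i < N"
  shows "\<delta> 1 i = 0"
proof -
  have n: "real (card (Act i)) > 0" using card_ge[OF i] by simp
  have row1: "row 1 i a b = 1 / real (card (Act i))" if a: "a \<in> Act i" and b: "b \<in> Act i" for a b
  proof -
    have g0: "grad 1 i a b = 0" for b by (simp add: grad_def v0)
    have "row 1 i a c = row 1 i a b" if "c \<in> Act i" for c
      using lb_argmax_foc[OF Act(1)[OF i] row_argmax[OF _ T_ge_one i a] that b] g0 by simp
    then have "(\<Sum>c\<in>Act i. row 1 i a c) = real (card (Act i)) * row 1 i a b" by simp
    then show ?thesis using row_simplex[OF _ T_ge_one i a] n by (simp add: prob_simplex_def field_simps)
  qed
  have "p 1 i b = p 0 i b" if b: "b \<in> Act i" for b
    using row_fixed[OF _ T_ge_one i b] row1[OF _ b] sum_pol[OF T_ge_one h i, of s] pol0[OF h i b, of s]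
    by (simp flip: sum_divide_distrib)
  then show ?thesis by (simp add: drift_def)
qed

section \<open>Swap regret\<close>

definition weighted_regret :: "nat \<Rightarrow> nat \<Rightarrow> ('a \<Rightarrow> 'a) \<Rightarrow> real" where
  "weighted_regret t i f = (\<Sum>j\<in>{1..t}. W j * (\<Sum>a\<in>Act i. p j i a * (u j i (f a) - u j i a)))"

lemma swap_regret_weighted:
  assumes "1 \<le> t"
  shows "swap_regret t h i s f = alpha_w H t 1 * weighted_regret t i f"
  unfolding swap_regret_def weighted_regret_def sum_distrib_left mult.assoc[symmetric]
  by (intro sum.cong) (auto simp: alpha_w_eq_wgt[of _ t H, simplified])

definition B :: "nat \<Rightarrow> real" where
  "B j = alpha H j * real H + real H * (\<Sum>k<N. \<delta> j k)"

definition S :: "nat \<Rightarrow> real" where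
  "S j = (\<Sum>k<N. (\<delta> j k)\<^sup>2)"

text \<open>One-round variation bound for the utility of row \<open>a\<close>. The agent's own drift
  enters here because \<open>v\<close> contains its policy. Each part keeps its dependence on
  \<open>a\<close>, so the sum over actions is \<open>B j\<close>, free of the number of
  actions.\<close>

definition \<beta> :: "nat \<Rightarrow> 'a \<Rightarrow> nat \<Rightarrow> real" where
  "\<beta> i a j = p j i a * (alpha H j * real H + real H * (\<Sum>k\<in>{..<N} - {i}. \<delta> j k))
     + real H * \<bar>p j i a - p (j - 1) i a\<bar>"

lemma B_sq:
  assumes "1 \<le> j"
  shows "(B j)\<^sup>2 \<le> 2 * (real H)\<^sup>2 * (alpha H j + real N * S j)"
proof -
  define D where "D = (\<Sum>k<N. \<delta> j k)"
  have al: "(alpha H j)\<^sup>2 \<le> alpha H j"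
    using alpha_pos[OF assms, of H] alpha_le_one[OF assms, of H]
    by (simp add: power2_eq_square mult_left_le)
  have D: "D\<^sup>2 \<le> real N * S j"
    using sum_squared_le_sum_of_squares[of "\<delta> j" "{..<N}"] by (simp add: D_def S_def mult.commute)
  have "0 \<le> (alpha H j - D)\<^sup>2" by simp
  then have "(alpha H j + D)\<^sup>2 \<le> 2 * ((alpha H j)\<^sup>2 + D\<^sup>2)"
    by (simp add: power2_eq_square algebra_simps)
  also have "\<dots> \<le> 2 * (alpha H j + real N * S j)" using al D by simp
  finally have "(real H)\<^sup>2 * (alpha H j + D)\<^sup>2 \<le> (real H)\<^sup>2 * (2 * (alpha H j + real N * S j))"
    by (intro mult_left_mono) auto
  moreover have "(B j)\<^sup>2 = (real H)\<^sup>2 * (alpha H j + D)\<^sup>2"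
    unfolding B_def D_def[symmetric] by (simp add: algebra_simps flip: power_mult_distrib)
  ultimately show ?thesis by (simp only: mult_ac)
qed

lemma v_diff:
  assumes j: "1 \<le> j" "j \<le> T" and i: "i < N" and a: "a \<in> Act i" and b: "b \<in> Act i"
  shows "\<bar>v i a j b - v i a (j - 1) b\<bar> \<le> \<beta> i a j"
proof -
  have j': "j - 1 \<le> T" "j \<in> {1..T}" using j by auto
  have "v i a j b - v i a (j - 1) b
      = p j i a * (u j i b - u (j - 1) i b) + (p j i a - p (j - 1) i a) * u (j - 1) i b"
    by (simp add: v_def algebra_simps)
  moreover have "\<bar>p j i a * (u j i b - u (j - 1) i b)\<bar>
      \<le> p j i a * (alpha H j * real H + real H * (\<Sum>k\<in>{..<N} - {i}. \<delta> j k))"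
    using util_diff[OF j'(2) h i b, of s] pol_nonneg[OF j(2) h i a, of s]
    by (simp add: abs_mult mult_left_mono)
  moreover have "\<bar>(p j i a - p (j - 1) i a) * u (j - 1) i b\<bar> \<le> real H * \<bar>p j i a - p (j - 1) i a\<bar>"
    using util_bounds[OF j'(1) h i b, of s] unfolding abs_mult mult.commute[of "real H"]
    by (intro mult_left_mono) auto
  ultimately show ?thesis unfolding \<beta>_def by linarith
qed

lemma sum_\<beta>:
  assumes "j \<le> T" "i < N"
  shows "(\<Sum>a\<in>Act i. \<beta> i a j) = B j"
proof -
  have "(\<Sum>a\<in>Act i. \<beta> i a j) = alpha H j * real H + real H * (\<Sum>k\<in>{..<N} - {i}. \<delta> j k)
      + real H * \<delta> j i"
    unfolding \<beta>_def drift_def[of j h i]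
    using sum_pol[OF assms(1) h assms(2), of s]
    by (simp add: sum.distrib flip: sum_distrib_right sum_distrib_left)
  also have "\<dots> = B j" unfolding B_def using assms sum.remove[of "{..<N}" i "\<delta> j"]
    by (simp add: distrib_left)
  finally show ?thesis .
qed

lemma sum_\<beta>_sq:
  assumes j: "1 \<le> j" "j \<le> T" and i: "i < N"
  shows "(\<Sum>a\<in>Act i. (\<beta> i a j)\<^sup>2) \<le> (B j)\<^sup>2"
proof -
  have \<beta>0: "0 \<le> \<beta> i a j" if "a \<in> Act i" for a
    using order_trans[OF abs_ge_zero v_diff[OF j i that that]] .
  have "(\<Sum>a\<in>Act i. (\<beta> i a j)\<^sup>2) \<le> (\<Sum>a\<in>Act i. \<beta> i a j * B j)"
  proof (rule sum_mono)
    fix a assume a: "a \<in> Act i"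
    have "\<beta> i a j \<le> B j" unfolding sum_\<beta>[OF j(2) i, symmetric]
      using \<beta>0 a Act(1)[OF i] by (intro member_le_sum) auto
    then show "(\<beta> i a j)\<^sup>2 \<le> \<beta> i a j * B j" using \<beta>0[OF a]
      by (simp add: power2_eq_square mult_left_mono)
  qed
  also have "\<dots> = (B j)\<^sup>2" using sum_\<beta>[OF j(2) i] by (simp add: power2_eq_square flip: sum_distrib_right)
  finally show ?thesis .
qed

text \<open>The part of the regret free of policy drift: the barrier at the comparators of all rows,
  the last round, the smoothing of the comparator, and the variation of the value estimates.\<close>

definition Z :: "nat \<Rightarrow> real" where
  "Z t = W t * A\<^sup>2 * ln (real T) / \<eta> + 4 * real H * W t + real H / real T * (\<Sum>j\<in>{1..t}. W j)
      + 3 * \<eta> * (real H)\<^sup>2 * (\<Sum>j\<in>{1..t}. W j * alpha H j)"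

lemma weighted_regret_le:
  assumes t: "1 \<le> t" "t \<le> T" and i: "i < N" and f: "f \<in> Act i \<rightarrow> Act i"
  shows "weighted_regret t i f \<le> Z t + 3 * \<eta> * (real H)\<^sup>2 * real N * (\<Sum>j\<in>{1..<t}. W j * S j)
     - 1 / (6 * \<eta>) * (\<Sum>j\<in>{1..<t}. W j * chg j i)"
proof -
  define n where "n = real (card (Act i))"
  have n: "1 \<le> n" "n \<le> A" using card_ge[OF i] card_le[OF i] by (auto simp: n_def)
  have T0: "0 < real T" using T_ge_one by simp
  have lnT: "0 \<le> ln (real T)" using T_ge_one by simp
  have fin: "finite (Act i)" using Act i by blast
  \<comment> \<open>The barrier is infinite at the point mass on \<open>f a\<close>, so a
    \<open>1 / real T\<close> share of the uniform distribution is mixed in. This costs at most H /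
    T per unit of weight and leaves a barrier of at most \<open>n * ln (real T)\<close>.\<close>
  define x where "x a b = (1 - 1 / real T) * (if b = f a then 1 else 0) + 1 / (real T * n)" for a b
  have xge: "1 / (real T * n) \<le> x a b" for a b using T_ge_one by (simp add: x_def)
  have xpos: "0 < x a b" for a b by (rule less_le_trans[OF _ xge]) (use T0 n in simp)
  have xsum: "(\<Sum>b\<in>Act i. x a b * y b) = (1 - 1 / real T) * y (f a) + 1 / (real T * n) * (\<Sum>b\<in>Act i. y b)"
    if "a \<in> Act i" for a y
  proof -
    have "f a \<in> Act i" using f that by auto
    have "x a b * y b = (if b = f a then (1 - 1 / real T) * y b else 0) + 1 / (real T * n) * y b" for b
      by (simp add: x_def distrib_right)
    then show ?thesis using fin \<open>f a \<in> Act i\<close> by (simp only: sum.distrib sum.delta sum_distrib_left) simp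
  qed
  have xs: "x a \<in> prob_simplex (Act i)" if "a \<in> Act i" for a
    using xsum[OF that, of "\<lambda>_. 1"] xpos n T0 by (simp add: prob_simplex_def less_imp_le n_def)
  have ln_x: "- (\<Sum>b\<in>Act i. ln (n * x a b)) \<le> A * ln (real T)" for a
  proof -
    have "(\<Sum>b\<in>Act i. - ln (real T)) \<le> (\<Sum>b\<in>Act i. ln (n * x a b))"
    proof (rule sum_mono)
      fix b
      have "1 / real T \<le> n * x a b" using mult_left_mono[OF xge[of a b], of n] n T0 by simp
      then have "ln (1 / real T) \<le> ln (n * x a b)" using T0 by (intro ln_mono) auto
      then show "- ln (real T) \<le> ln (n * x a b)" using T0 by (simp add: ln_div)
    qed
    then have "- (\<Sum>b\<in>Act i. ln (n * x a b)) \<le> n * ln (real T)" by (simp add: n_def)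
    also have "\<dots> \<le> A * ln (real T)" using n lnT by (intro mult_right_mono) auto
    finally show ?thesis .
  qed
  \<comment> \<open>Proportional to the policy, so that the last-round terms of all rows sum to
    order \<open>H\<close> rather than to \<open>H\<close> times the number of actions.\<close>
  define \<gamma> where "\<gamma> a = real H * (p t i a + p (t - 1) i a)" for a
  have t': "t - 1 \<le> T" using t by simp
  have v\<gamma>: "\<bar>v i a t b - v i a (t - 1) b\<bar> \<le> \<gamma> a" if "a \<in> Act i" "b \<in> Act i" for a b
    using v_bounds[OF t(2) i that] v_bounds[OF t' i that] unfolding \<gamma>_def by (simp add: distrib_left)
  have \<gamma>sum: "(\<Sum>a\<in>Act i. \<gamma> a) = 2 * real H"
    using sum_pol[OF t(2) h i, of s] sum_pol[OF t' h i, of s]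
    by (simp add: \<gamma>_def sum.distrib flip: sum_distrib_left)
  have row: "(\<Sum>j\<in>{1..t}. W j * (\<Sum>b\<in>Act i. (x a b - row j i a b) * v i a j b))
     \<le> W t / \<eta> * (A * ln (real T)) + 2 * \<gamma> a * W t
       + (\<Sum>j\<in>{1..<t}. W j * (3 * \<eta> / 2 * (\<beta> i a j)\<^sup>2 - 1 / (6 * \<eta>) * (\<Sum>b\<in>Act i. (rel j i a b)\<^sup>2)))"
    if a: "a \<in> Act i" for a
  proof -
    have stab: "\<bar>row (Suc j) i a b / row j i a b - 1\<bar> \<le> 1 / 2"
      if j: "1 \<le> j" "j < t" and b: "b \<in> Act i" for j b
    proof -
      have jT: "j < T" "1 \<le> Suc j" "Suc j \<le> T" using j t by auto
      have "(\<Sum>b\<in>Act i. row (Suc j) i a b) = 1" "\<forall>b\<in>Act i. 0 \<le> row (Suc j) i a b"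
        using row_simplex[OF jT(2,3) i a] by (auto simp: prob_simplex_def)
      then have "row (Suc j) i a b \<le> 1" using member_le_sum[of b "Act i" "row (Suc j) i a"] fin b by auto
      then show ?thesis using rel_bound[OF j(1) jT(1) i a b] by (simp add: rel_def)
    qed
    have "(\<Sum>j\<in>{1..t}. W j * (\<Sum>b\<in>Act i. (x a b - row j i a b) * v i a j b))
     \<le> W t / \<eta> * (- (\<Sum>b\<in>Act i. ln (real (card (Act i)) * x a b))) + 2 * \<gamma> a * W t
       + (\<Sum>j\<in>{1..<t}. W j * (3 * \<eta> / 2 * (\<beta> i a j)\<^sup>2
            - 1 / (6 * \<eta>) * (\<Sum>b\<in>Act i. (row (Suc j) i a b / row j i a b - 1)\<^sup>2)))"
    proof (rule oftrl_log_barrier_regret[OF fin eta_pos t(1)])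
      show "is_lb_argmax (Act i)
          (\<lambda>b. \<eta> * ((\<Sum>j\<in>{1..<k}. W j * v i a j b) + W k * v i a (k - 1) b) / W k) (row k i a)"
        if "1 \<le> k" "k \<le> t" for k
        using row_argmax[of k i a] that t i a by (simp add: grad_def[abs_def])
    qed (use t i a W_pos W_mono v0 stab v_diff v\<gamma> xs xpos in auto)
    also have "W t / \<eta> * (- (\<Sum>b\<in>Act i. ln (real (card (Act i)) * x a b))) \<le> W t / \<eta> * (A * ln (real T))"
      using ln_x[of a] W_pos[OF t(1)] eta_pos unfolding n_def by (intro mult_left_mono) auto
    finally show ?thesis by (simp add: rel_def)
  qed
  have "weighted_regret t i f - real H / real T * (\<Sum>j\<in>{1..t}. W j)
      = (\<Sum>j\<in>{1..t}. W j * ((\<Sum>a\<in>Act i. p j i a * (u j i (f a) - u j i a)) - real H / real T))"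
    unfolding weighted_regret_def by (simp only: right_diff_distrib sum_subtractf sum_distrib_left mult.commute)
  also have "\<dots> \<le> (\<Sum>j\<in>{1..t}. W j * (\<Sum>a\<in>Act i. \<Sum>b\<in>Act i. (x a b - row j i a b) * v i a j b))"
  proof (intro sum_mono mult_left_mono)
    fix j assume "j \<in> {1..t}"
    then have j: "1 \<le> j" "j \<le> T" using t by auto
    show "0 \<le> W j" using W_pos[OF j(1)] by simp
    have lo: "p j i a * u j i (f a) - real H / real T * p j i a \<le> (\<Sum>b\<in>Act i. x a b * v i a j b)"
      if a: "a \<in> Act i" for a
    proof -
      have fa: "f a \<in> Act i" using f a by auto
      have "0 \<le> 1 / (real T * n) * (\<Sum>b\<in>Act i. v i a j b)"
        using T0 n v_bounds(1)[OF j(2) i a] by (intro mult_nonneg_nonneg sum_nonneg) auto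
      moreover have "1 / real T * v i a j (f a) \<le> 1 / real T * (real H * p j i a)"
        using v_bounds(2)[OF j(2) i a fa] by (intro mult_left_mono) auto
      ultimately show ?thesis unfolding xsum[OF a] by (simp add: v_def left_diff_distrib)
    qed
    have "(\<Sum>a\<in>Act i. p j i a * (u j i (f a) - u j i a)) - real H / real T
        = (\<Sum>a\<in>Act i. p j i a * u j i (f a) - real H / real T * p j i a) - (\<Sum>b\<in>Act i. p j i b * u j i b)"
      using sum_pol[OF j(2) h i, of s]
      by (simp add: right_diff_distrib sum_subtractf flip: sum_distrib_left sum_divide_distrib)
    also have "\<dots> \<le> (\<Sum>a\<in>Act i. \<Sum>b\<in>Act i. x a b * v i a j b) - (\<Sum>b\<in>Act i. p j i b * u j i b)"
      by (intro diff_right_mono sum_mono lo)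
    \<comment> \<open>The fixed-point equation turns the utility of the played policy into the total
      utility of the rows, each row \<open>a\<close> weighted by \<open>p j i a\<close>.\<close>
    also have "(\<Sum>b\<in>Act i. p j i b * u j i b) = (\<Sum>b\<in>Act i. (\<Sum>a\<in>Act i. p j i a * row j i a b) * u j i b)"
      using row_fixed[OF j i] by (intro sum.cong) auto
    also have "\<dots> = (\<Sum>a\<in>Act i. \<Sum>b\<in>Act i. row j i a b * v i a j b)"
      unfolding sum_distrib_right by (subst sum.swap) (simp add: v_def mult_ac)
    also have "(\<Sum>a\<in>Act i. \<Sum>b\<in>Act i. x a b * v i a j b) - (\<Sum>a\<in>Act i. \<Sum>b\<in>Act i. row j i a b * v i a j b)
        = (\<Sum>a\<in>Act i. \<Sum>b\<in>Act i. (x a b - row j i a b) * v i a j b)"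
      by (simp only: left_diff_distrib sum_subtractf)
    finally show "(\<Sum>a\<in>Act i. p j i a * (u j i (f a) - u j i a)) - real H / real T
        \<le> (\<Sum>a\<in>Act i. \<Sum>b\<in>Act i. (x a b - row j i a b) * v i a j b)" .
  qed
  also have "\<dots> = (\<Sum>a\<in>Act i. \<Sum>j\<in>{1..t}. W j * (\<Sum>b\<in>Act i. (x a b - row j i a b) * v i a j b))"
    unfolding sum_distrib_left by (subst sum.swap) simp
  also have "\<dots> \<le> (\<Sum>a\<in>Act i. W t / \<eta> * (A * ln (real T)) + 2 * \<gamma> a * W t
       + (\<Sum>j\<in>{1..<t}. W j * (3 * \<eta> / 2 * (\<beta> i a j)\<^sup>2 - 1 / (6 * \<eta>) * (\<Sum>b\<in>Act i. (rel j i a b)\<^sup>2))))"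
    by (intro sum_mono row)
  also have "\<dots> = n * (W t / \<eta> * (A * ln (real T))) + 2 * (\<Sum>a\<in>Act i. \<gamma> a) * W t
       + (\<Sum>a\<in>Act i. \<Sum>j\<in>{1..<t}. W j * (3 * \<eta> / 2 * (\<beta> i a j)\<^sup>2 - 1 / (6 * \<eta>) * (\<Sum>b\<in>Act i. (rel j i a b)\<^sup>2)))"
  proof -
    have "(\<Sum>a\<in>Act i. c + 2 * \<gamma> a * w + g a) = n * c + 2 * (\<Sum>a\<in>Act i. \<gamma> a) * w + (\<Sum>a\<in>Act i. g a)"
      for c w g by (simp add: sum.distrib n_def sum_distrib_left sum_distrib_right)
    then show ?thesis .
  qed
  also have "(\<Sum>a\<in>Act i. \<Sum>j\<in>{1..<t}. W j * (3 * \<eta> / 2 * (\<beta> i a j)\<^sup>2 - 1 / (6 * \<eta>) * (\<Sum>b\<in>Act i. (rel j i a b)\<^sup>2)))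
      = (\<Sum>j\<in>{1..<t}. W j * (3 * \<eta> / 2 * (\<Sum>a\<in>Act i. (\<beta> i a j)\<^sup>2) - 1 / (6 * \<eta>) * chg j i))"
    unfolding chg_def by (subst sum.swap) (simp only: sum_subtractf flip: sum_distrib_left)
  also have "\<dots> \<le> (\<Sum>j\<in>{1..<t}. W j * (3 * \<eta> * (real H)\<^sup>2 * (alpha H j + real N * S j) - 1 / (6 * \<eta>) * chg j i))"
  proof (intro sum_mono mult_left_mono diff_right_mono)
    fix j assume "j \<in> {1..<t}"
    then have j: "1 \<le> j" "j \<le> T" using t by auto
    show "0 \<le> W j" using W_pos[OF j(1)] by simp
    have "(\<Sum>a\<in>Act i. (\<beta> i a j)\<^sup>2) \<le> 2 * (real H)\<^sup>2 * (alpha H j + real N * S j)"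
      using sum_\<beta>_sq[OF j i] B_sq[OF j(1)] by linarith
    then have "3 * \<eta> / 2 * (\<Sum>a\<in>Act i. (\<beta> i a j)\<^sup>2)
        \<le> 3 * \<eta> / 2 * (2 * (real H)\<^sup>2 * (alpha H j + real N * S j))"
      using eta_pos by (intro mult_left_mono) auto
    also have "\<dots> = 3 * \<eta> * (real H)\<^sup>2 * (alpha H j + real N * S j)" by simp
    finally show "3 * \<eta> / 2 * (\<Sum>a\<in>Act i. (\<beta> i a j)\<^sup>2)
        \<le> 3 * \<eta> * (real H)\<^sup>2 * (alpha H j + real N * S j)" .
  qed
  also have "\<dots> = 3 * \<eta> * (real H)\<^sup>2 * (\<Sum>j\<in>{1..<t}. W j * alpha H j)
      + 3 * \<eta> * (real H)\<^sup>2 * real N * (\<Sum>j\<in>{1..<t}. W j * S j)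
      - 1 / (6 * \<eta>) * (\<Sum>j\<in>{1..<t}. W j * chg j i)"
    unfolding sum_distrib_left sum.distrib[symmetric] sum_subtractf[symmetric]
    by (intro sum.cong) (simp_all add: algebra_simps)
  finally have main: "weighted_regret t i f - real H / real T * (\<Sum>j\<in>{1..t}. W j)
      \<le> n * (W t / \<eta> * (A * ln (real T))) + 2 * (2 * real H) * W t
        + (3 * \<eta> * (real H)\<^sup>2 * (\<Sum>j\<in>{1..<t}. W j * alpha H j)
          + 3 * \<eta> * (real H)\<^sup>2 * real N * (\<Sum>j\<in>{1..<t}. W j * S j)
          - 1 / (6 * \<eta>) * (\<Sum>j\<in>{1..<t}. W j * chg j i))"
    unfolding \<gamma>sum by simp
  have "n * (W t / \<eta> * (A * ln (real T))) \<le> A * (W t / \<eta> * (A * ln (real T)))"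
    using n lnT W_pos[OF t(1)] eta_pos A_ge_one by (intro mult_right_mono) auto
  also have "\<dots> = W t * A\<^sup>2 * ln (real T) / \<eta>" by (simp add: power2_eq_square)
  finally have nA: "n * (W t / \<eta> * (A * ln (real T))) \<le> W t * A\<^sup>2 * ln (real T) / \<eta>" .
  have "(\<Sum>j\<in>{1..<t}. W j * alpha H j) \<le> (\<Sum>j\<in>{1..t}. W j * alpha H j)"
    using W_pos alpha_pos by (intro sum_mono2) (auto simp: less_imp_le)
  then have "3 * \<eta> * (real H)\<^sup>2 * (\<Sum>j\<in>{1..<t}. W j * alpha H j)
      \<le> 3 * \<eta> * (real H)\<^sup>2 * (\<Sum>j\<in>{1..t}. W j * alpha H j)"
    using eta_pos by (intro mult_left_mono) auto
  then show ?thesis using main nA unfolding Z_def by linarith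
qed

text \<open>The drift at round t + 1 is paid by the row changes at round t; the shift of the weight
  costs \<open>2 * real H\<close> and \<open>drift_chg\<close> costs \<open>16 * A\<close>.\<close>

lemma sum_drift_le:
  assumes "1 \<le> t" "t \<le> T" and i: "i < N"
  shows "(\<Sum>j\<in>{1..t}. W j * (\<delta> j i)\<^sup>2) \<le> 32 * real H * A * (\<Sum>j\<in>{1..<t}. W j * chg j i)"
  using assms(1,2)
proof (induction t rule: nat_induct_at_least)
  case base
  then show ?case using drift_one[OF i] by simp
next
  case (Suc t)
  have c0: "0 \<le> chg t i" by (auto simp: chg_def intro!: sum_nonneg)
  have "W (Suc t) * (\<delta> (Suc t) i)\<^sup>2 \<le> (2 * real H * W t) * (16 * A * chg t i)"
    using W_Suc_le[OF Suc.hyps] drift_chg[of t i] Suc i W_pos[OF Suc.hyps]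
    by (intro mult_mono) auto
  also have "\<dots> = 32 * real H * A * (W t * chg t i)" by simp
  finally show ?case using Suc by (simp add: distrib_left)
qed

text \<open>The identity modification has zero regret for every agent, so adding up the regret bounds of all
  agents controls the total drift of the policies.\<close>
lemma weighted_regret_bound:
  assumes t: "1 \<le> t" "t \<le> T" and i: "i < N" and f: "f \<in> Act i \<rightarrow> Act i"
  shows "weighted_regret t i f \<le> 2 * Z t"
proof -
  define c where "c = 3 * \<eta> * (real H)\<^sup>2 * real N"
  define X where "X k = (\<Sum>j\<in>{1..<t}. W j * chg j k)" for k
  define Y where "Y = (\<Sum>j\<in>{1..t}. W j * S j)"
  have c0: "0 \<le> c" using eta_pos by (simp add: c_def)
  have WS: "0 \<le> W j * S j" if "1 \<le> j" for j
    using W_pos[OF that] by (auto simp: S_def intro!: mult_nonneg_nonneg sum_nonneg)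
  have X0: "0 \<le> X k" for k
    using W_pos by (auto simp: X_def chg_def less_imp_le intro!: sum_nonneg mult_nonneg_nonneg)
  have Y0: "0 \<le> Y" using WS by (auto simp: Y_def intro!: sum_nonneg)
  have "(\<Sum>j\<in>{1..<t}. W j * S j) \<le> Y" unfolding Y_def using WS by (intro sum_mono2) auto
  then have cY: "c * (\<Sum>j\<in>{1..<t}. W j * S j) \<le> c * Y" using c0 by (rule mult_left_mono)
  have weighted_regret: "weighted_regret t k g \<le> Z t + c * Y - 1 / (6 * \<eta>) * X k" if "k < N" "g \<in> Act k \<rightarrow> Act k" for k g
    using weighted_regret_le[OF t that] cY by (simp add: c_def X_def)
  have "0 \<le> (\<Sum>k<N. Z t + c * Y - 1 / (6 * \<eta>) * X k)"
  proof (rule sum_nonneg)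
    fix k assume "k \<in> {..<N}"
    moreover have "weighted_regret t k (\<lambda>a. a) = 0" by (simp add: weighted_regret_def)
    ultimately show "0 \<le> Z t + c * Y - 1 / (6 * \<eta>) * X k" using weighted_regret[of k "\<lambda>a. a"] by auto
  qed
  then have sumX: "(\<Sum>k<N. X k) \<le> 6 * \<eta> * real N * (Z t + c * Y)"
    using eta_pos by (simp add: sum_subtractf field_simps flip: sum_divide_distrib)
  have "Y = (\<Sum>k<N. \<Sum>j\<in>{1..t}. W j * (\<delta> j k)\<^sup>2)"
    unfolding Y_def S_def sum_distrib_left by (rule sum.swap)
  also have "\<dots> \<le> (\<Sum>k<N. 32 * real H * A * X k)"
    unfolding X_def using sum_drift_le[OF t] by (intro sum_mono) auto
  also have "\<dots> = 32 * real H * A * (\<Sum>k<N. X k)" by (simp add: sum_distrib_left)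
  also have "\<dots> \<le> 32 * real H * A * (6 * \<eta> * real N * (Z t + c * Y))"
    using sumX A_ge_one by (intro mult_left_mono) auto
  finally have "c * Y \<le> c * (32 * real H * A * (6 * \<eta> * real N * (Z t + c * Y)))"
    using c0 by (rule mult_left_mono)
  also have "\<dots> = 576 * (\<eta>\<^sup>2 * (real N)\<^sup>2 * real H ^ 3 * A) * (Z t + c * Y)"
    by (simp add: c_def power2_eq_square power3_eq_cube)
  also have "\<dots> = 576 / 65536 * (Z t + c * Y)" unfolding eta_sq by simp
  finally have "c * Y \<le> 576 / 65536 * (Z t + c * Y)" .
  \<comment> \<open>Any positive factor up to 1/2 absorbs the drift into the drift-free part in this
    way.\<close>
  moreover have "y \<le> z" if "y \<le> 576 / 65536 * (z + y)" "0 \<le> y" for y z :: real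
    using that by simp
  ultimately have "c * Y \<le> Z t" using mult_nonneg_nonneg[OF c0 Y0] by blast
  moreover have "0 \<le> 1 / (6 * \<eta>) * X i" using X0 eta_pos by (intro mult_nonneg_nonneg) auto
  ultimately show ?thesis using weighted_regret[OF i f] by linarith
qed

text \<open>Keeps the logarithm away from 0, so that the terms without \<open>ln (real T)\<close>
  can be absorbed by the leading one.\<close>

lemma ln_T_ge: "1 / 2 \<le> ln (real T)"
proof -
  have "exp (1 / 2 :: real) \<le> 1 + 1 / 2 + (1 / 2)\<^sup>2" by (rule exp_bound) auto
  also have "\<dots> \<le> real T" using T_ge_two by (simp add: power2_eq_square)
  finally have "ln (exp (1 / 2)) \<le> ln (real T)" using T_ge_two by (intro ln_mono) auto
  then show ?thesis by simp
qed

lemma alpha_le: "1 \<le> t \<Longrightarrow> alpha H t \<le> 2 * real H / real t"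
proof -
  assume t: "1 \<le> t"
  have "(real H + 1) / (real H + real t) \<le> 2 * real H / real t"
    using t H_ge_one by (intro frac_le) auto
  then show ?thesis by (simp add: alpha_def)
qed

text \<open>Multiplication by \<open>alpha_w H t 1\<close> restores the averaging weights, after
  which every part of \<open>Z t\<close> decays like 1 / t. The leading part is at most
  \<open>2 * real H * L / real t\<close>; the rest is absorbed by doubling it, and
  \<open>weighted_regret_bound\<close> doubles once more.\<close>

lemma swap_regret_bound:
  assumes t: "1 \<le> t" "t \<le> T" and i: "i < N" and f: "f \<in> Act i \<rightarrow> Act i"
  shows "swap_regret t h i s f \<le> (8 * real H * A\<^sup>2 * ln (real T) / \<eta>) / real t"
proof -
  define w where "w = alpha_w H t 1"
  define L where "L = A\<^sup>2 * ln (real T) / \<eta>"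
  have w: "0 \<le> w" using alpha_w_pos[of 1 t H] t by (simp add: w_def)
  have wW: "w * W j = alpha_w H t j" if "1 \<le> j" "j \<le> t" for j
    unfolding w_def by (rule alpha_w_eq_wgt[OF that])
  have wsum: "w * (\<Sum>j\<in>{1..t}. W j * y j) = (\<Sum>j\<in>{1..t}. alpha_w H t j * y j)" for y
    unfolding sum_distrib_left mult.assoc[symmetric] by (intro sum.cong) (auto simp: wW)
  have wt: "w * W t = alpha H t" using wW[of t] t by (simp add: alpha_w_self)
  have w1: "w * (\<Sum>j\<in>{1..t}. W j) = 1" using wsum[of "\<lambda>_. 1"] sum_alpha_w[OF t(1)] by simp
  have "w * Z t = (w * W t) * L + 4 * real H * (w * W t) + real H / real T * (w * (\<Sum>j\<in>{1..t}. W j))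
      + 3 * \<eta> * (real H)\<^sup>2 * (w * (\<Sum>j\<in>{1..t}. W j * alpha H j))"
    by (simp add: Z_def L_def algebra_simps)
  then have wZ: "w * Z t = alpha H t * L + 4 * real H * alpha H t + real H / real T
      + 3 * \<eta> * (real H)\<^sup>2 * (\<Sum>j\<in>{1..t}. alpha_w H t j * alpha H j)"
    unfolding wt w1 wsum by simp
  have L: "128 * real H \<le> L"
  proof -
    have "1 * (1 / 2) \<le> A\<^sup>2 * ln (real T)" using A_ge_one ln_T_ge by (intro mult_mono) auto
    then have "(256 * real H) * (1 / 2) \<le> (1 / \<eta>) * (A\<^sup>2 * ln (real T))"
      using eta_inv_ge eta_pos by (intro mult_mono) auto
    then show ?thesis by (simp add: L_def)
  qed
  have t0: "0 < real t" using t by simp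
  have "(\<Sum>j\<in>{1..t}. alpha_w H t j * alpha H j) \<le> (\<Sum>j\<in>{1..t}. 2 * real H * (alpha_w H t j * (1 / real j)))"
  proof (rule sum_mono)
    fix j assume j: "j \<in> {1..t}"
    have "alpha_w H t j * alpha H j \<le> alpha_w H t j * (2 * real H / real j)"
      using alpha_le[of j] alpha_w_pos[of j t H] j by (intro mult_left_mono) auto
    then show "alpha_w H t j * alpha H j \<le> 2 * real H * (alpha_w H t j * (1 / real j))"
      by (simp add: mult_ac)
  qed
  also have "\<dots> \<le> 2 * real H * ((1 + 1 / real H) / real t)"
    unfolding sum_distrib_left[symmetric] by (intro mult_left_mono sum_alpha_w_inverse H_ge_one t) auto
  also have "\<dots> \<le> 2 * real H * (2 / real t)"
    using t0 H_ge_one by (intro mult_left_mono divide_right_mono) auto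
  finally have "3 * \<eta> * (real H)\<^sup>2 * (\<Sum>j\<in>{1..t}. alpha_w H t j * alpha H j)
      \<le> 3 * \<eta> * (real H)\<^sup>2 * (2 * real H * (2 / real t))"
    using eta_pos by (intro mult_left_mono) auto
  also have "\<dots> = (\<eta> * real H) * (12 * (real H)\<^sup>2) / real t" by (simp add: power2_eq_square)
  also have "\<dots> \<le> 1 * (12 * (real H)\<^sup>2) / real t"
    using eta_H t0 by (intro divide_right_mono mult_right_mono) auto
  finally have 1: "3 * \<eta> * (real H)\<^sup>2 * (\<Sum>j\<in>{1..t}. alpha_w H t j * alpha H j) \<le> 12 * (real H)\<^sup>2 / real t"
    by simp
  have 2: "alpha H t * (L + 4 * real H) \<le> 2 * real H / real t * (L + 4 * real H)"
    using alpha_le[OF t(1)] L by (intro mult_right_mono) auto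
  have "real H * 1 \<le> real H * real H" using H_ge_one by (intro mult_left_mono) auto
  then have H2: "real H \<le> (real H)\<^sup>2" by (simp add: power2_eq_square)
  have 3: "real H / real T \<le> (real H)\<^sup>2 / real t" using t t0 H2 by (intro frac_le) auto
  have "w * Z t = alpha H t * (L + 4 * real H) + real H / real T
      + 3 * \<eta> * (real H)\<^sup>2 * (\<Sum>j\<in>{1..t}. alpha_w H t j * alpha H j)"
    unfolding wZ by (simp add: algebra_simps)
  also have "\<dots> \<le> 2 * real H / real t * (L + 4 * real H) + (real H)\<^sup>2 / real t + 12 * (real H)\<^sup>2 / real t"
    by (intro add_mono 1 2 3)
  \<comment> \<open>21 = 8 + 1 + 12, from the last round, the smoothing and the value variation;
    \<open>L\<close> is at least \<open>128 * real H\<close>, so these stay below the leading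
    term.\<close>
  also have "\<dots> = (2 * real H * L + 21 * (real H)\<^sup>2) / real t"
    by (simp add: add_divide_distrib algebra_simps power2_eq_square)
  also have "\<dots> \<le> 4 * real H * L / real t"
  proof -
    have "real H * (128 * real H) \<le> real H * L" using L by (intro mult_left_mono) auto
    then have "128 * (real H)\<^sup>2 \<le> real H * L" by (simp add: power2_eq_square)
    then have "2 * (real H * L) + 21 * (real H)\<^sup>2 \<le> 4 * (real H * L)"
      using zero_le_power2[of "real H"] by linarith
    then show ?thesis using t0 by (intro divide_right_mono) (auto simp: mult.assoc)
  qed
  finally have "w * (2 * Z t) \<le> 8 * real H * L / real t" by simp
  moreover have "swap_regret t h i s f \<le> w * (2 * Z t)"
    unfolding swap_regret_weighted[OF t(1)] w_def[symmetric]
    by (intro mult_left_mono weighted_regret_bound t i f w)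
  ultimately show ?thesis by (simp add: L_def mult.assoc)
qed

end

section \<open>Assembly over the horizon\<close>

lemma sum_power_one_plus_inverse:
  assumes "H \<ge> 1"
  shows "(\<Sum>k<H. (1 + 1 / real H) ^ k) \<le> 3 * real H"
proof -
  have "(\<Sum>k<H. (1 + 1 / real H) ^ k) \<le> (\<Sum>k<H. 3)"
  proof (rule sum_mono)
    fix k assume "k \<in> {..<H}"
    then have "(1 + 1 / real H) ^ k \<le> (1 + 1 / real H) ^ H" by (intro power_increasing) auto
    also have "\<dots> \<le> exp 1" using exp_ge_one_plus_x_over_n_power_n[of H 1] assms by simp
    also have "\<dots> \<le> 3" by (rule exp_le)
    finally show "(1 + 1 / real H) ^ k \<le> 3" .
  qed
  then show ?thesis by (simp add: mult.commute)
qed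

theorem theorem1:
  fixes N H T :: nat
    and Act :: "nat \<Rightarrow> 'a set"
    and r :: "nat \<Rightarrow> nat \<Rightarrow> 's::finite \<Rightarrow> (nat \<Rightarrow> 'a) \<Rightarrow> real"
    and P :: "nat \<Rightarrow> 's \<Rightarrow> (nat \<Rightarrow> 'a) \<Rightarrow> 's \<Rightarrow> real"
    and s1 :: 's
    and pol :: "nat \<Rightarrow> nat \<Rightarrow> nat \<Rightarrow> 's \<Rightarrow> 'a \<Rightarrow> real"
    and Q :: "nat \<Rightarrow> nat \<Rightarrow> nat \<Rightarrow> 's \<Rightarrow> (nat \<Rightarrow> 'a) \<Rightarrow> real"
  assumes "N \<ge> 1" and "H \<ge> 1" and "T \<ge> 2"
    and "\<forall>i<N. finite (Act i) \<and> Act i \<noteq> {}"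
    and "\<forall>h\<in>{1..H}. \<forall>i<N. \<forall>s. \<forall>a\<in>joint N Act. 0 \<le> r h i s a \<and> r h i s a \<le> 1"
    and "\<forall>h\<in>{1..H}. \<forall>s. \<forall>a\<in>joint N Act. (\<forall>s'. 0 \<le> P h s a s') \<and> (\<Sum>s'\<in>UNIV. P h s a s') = 1"
    and "bm_oftrl_run N H Act r P
           (1 / (256 * real N * real H * sqrt (real H * real (A_max N Act)))) T pol Q"
  shows "ce_gap N H Act r P pol T s1
           \<le> 6144 * real N * real H powr (7/2) * real (A_max N Act) powr (5/2) * ln (real T) / real T"
proof -
  define \<eta> where "\<eta> = 1 / (256 * real N * real H * sqrt (real H * real (A_max N Act)))"
  interpret bm_oftrl_tuned N H T Act r P pol Q \<eta>
  proof unfold_locales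
    show "bm_oftrl_run N H Act r P \<eta> T pol Q" unfolding \<eta>_def by (rule assms(7))
  qed (use assms(1-6) \<eta>_def in auto)
  define C where "C = 8 * real H * A\<^sup>2 * ln (real T) / \<eta>"
  have C0: "0 \<le> C" using T_ge_one eta_pos by (simp add: C_def)
  define bound where "bound = 6144 * real N * real H powr (7/2) * A powr (5/2) * ln (real T) / real T"
  have hs: "real H powr (7 / 2) = real H ^ 3 * sqrt (real H)"
  proof -
    have "real H powr (7 / 2) = real H powr (real 3 + 1 / 2)" by simp
    then show ?thesis using H_ge_one by (simp only: powr_add) (simp add: powr_half_sqrt powr_realpow)
  qed
  have as: "A powr (5 / 2) = A ^ 2 * sqrt A"
  proof -
    have "A powr (5 / 2) = A powr (real 2 + 1 / 2)" by simp
    then show ?thesis using A_ge_one by (simp only: powr_add) (simp add: powr_half_sqrt powr_realpow)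
  qed
  \<comment> \<open>6144 = 3 * 8 * 256. The powers of \<open>H\<close> are one from the recursion,
    one from \<open>C\<close> and three halves from 1 / \<eta>, which also adds the square root of
    \<open>A\<close> to \<open>A\<^sup>2\<close>.\<close>
  have bound: "3 * real H * C / real T = bound"
    unfolding bound_def hs as C_def \<eta>_def
    by (simp add: real_sqrt_mult power2_eq_square power3_eq_cube)
  have "Vout N H Act r P pol i \<phi> H T s1 - Vout N H Act r P pol i (\<lambda>h s a. a) H T s1 \<le> bound"
    if i: "i < N" and \<phi>: "\<phi> \<in> strat_mods Act i" for i \<phi>
  proof -
    have "swap_regret t h i s f \<le> C / real t"
      if "t \<in> {1..T}" "h \<in> {1..H}" "f \<in> Act i \<rightarrow> Act i" for t h s f
    proof -
      interpret bm_oftrl_state N H T Act r P pol Q \<eta> h s by unfold_locales (rule that(2))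
      show ?thesis unfolding C_def using that i by (intro swap_regret_bound) auto
    qed
    then have "Vout N H Act r P pol i \<phi> H T s1 - Vout N H Act r P pol i (\<lambda>h s a. a) H T s1
        \<le> (\<Sum>k<H. (1 + 1 / real H) ^ k) * C / real T"
      using T_ge_one by (intro Vout_gap[OF i \<phi> C0]) auto
    also have "\<dots> \<le> 3 * real H * C / real T"
      using sum_power_one_plus_inverse[OF H_ge_one] C0 by (intro divide_right_mono mult_right_mono) auto
    finally show ?thesis unfolding bound .
  qed
  \<comment> \<open>\<open>cSUP_least\<close> applies to a nonempty index set; the identity
    modification of agent 0 is a member.\<close>
  moreover have "(0, \<lambda>h s a. a) \<in> {(i, \<phi>). i < N \<and> \<phi> \<in> strat_mods Act i}"
    using N_ge_one by (simp add: strat_mods_def)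
  ultimately show ?thesis
    unfolding ce_gap_def bound_def[symmetric] by (intro cSUP_least) auto
qed

end
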